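(* Let $X$ be a pure $d$-dimensional simplicial complex, and let $0\le \ell<k\le d$. Then, for all $1\le i\le |X(k)|$, \[ (k-\ell)\cdot \lambda_i\big(\tilde{L}_k(X)\big) \ge (k+1)\cdot \lambda_i\Big(\bigoplus_{\eta\in X(\ell)} \tilde{L}_{k-\ell-1}(\mathrm{lk}(X,\eta))\Big) - (\ell+1)(d-k). \]
   Context: Let $X$ be a simplicial complex on a finite vertex set $V$ with an arbitrary fixed linear order $<$ on $V$. $X(k)$ denotes the set of $k$-dimensional faces of $X$. For $\sigma\in X(k-1)$, $\tau\in X(k)$ with $\sigma\subset\tau$, set $(\tau:\sigma)=(-1)^{|\{v\in\tau: v<u\}|}$ where $u$ is the unique vertex of $\tau\setminus\sigma$; the boundary matrix $\partial_k(X)\in\mathbb{R}^{X(k-1)\times X(k)}$ has entries $(\tau:\sigma)$ if $\sigma\subset\tau$ and $0$ otherwise. For a pure $d$-dimensional complex $X$ (all maximal faces have dimension $d$), define $w(\sigma)=|\{\tau\in X(d):\sigma\subset\tau\}|$ and let $W_k(X)$ be the diagonal $X(k)\times X(k)$ matrix with entries $w(\sigma)$. For $0\le k\le d-1$, $\tilde{L}_k(X)=W_k(X)^{-1}\partial_{k+1}(X)W_{k+1}(X)\partial_{k+1}(X)^T+\partial_k(X)^T W_{k-1}(X)^{-1}\partial_k(X)W_k(X)$, and $\tilde{L}_d(X)=\partial_d(X)^T W_{d-1}(X)^{-1}\partial_d(X)W_d(X)$; these matrices are diagonalizable with nonnegative real eigenvalues. $\mathrm{lk}(X,\sigma)=\{\tau\in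 X:\tau\cap\sigma=\emptyset,\ \tau\cup\sigma\in X\}$ is the link of $\sigma$; for $\eta\in X(\ell)$ it is a pure $(d-\ell-1)$-dimensional complex and $\tilde{L}$ on it is defined the same way with its own weight function. For a diagonalizable matrix $M$ with real eigenvalues, $\lambda_i(M)$ denotes its $i$-th smallest eigenvalue; $\bigoplus$ denotes the block-diagonal direct sum of matrices. *)

theory Defs
  imports
    "Jordan_Normal_Form.Char_Poly"
    "Jordan_Normal_Form.Gauss_Jordan_Elimination"
begin

definition abstract_complex :: "'a set \<Rightarrow> 'a set set \<Rightarrow> bool" where
  "abstract_complex V X \<longleftrightarrow>
     finite V \<and> X \<subseteq> Pow V \<and> {} \<in> X \<and> (\<forall>\<tau>\<in>X. \<forall>\<sigma>. \<sigma> \<subseteq> \<tau> \<longrightarrow> \<sigma> \<in> X)"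

text \<open>Dimensions are integers, since the empty face has dimension \<open>-1\<close>.\<close>

definition face_dim :: "'a set \<Rightarrow> int" where
  "face_dim \<sigma> = int (card \<sigma>) - 1"

definition faces :: "'a set set \<Rightarrow> int \<Rightarrow> 'a set set" where
  "faces X k = {\<sigma>\<in>X. face_dim \<sigma> = k}"

definition complex_dim :: "'a set set \<Rightarrow> int" where
  "complex_dim X = Max (face_dim ` X)"

definition maximal_face :: "'a set set \<Rightarrow> 'a set \<Rightarrow> bool" where
  "maximal_face X \<sigma> \<longleftrightarrow> \<sigma> \<in> X \<and> (\<forall>\<tau>\<in>X. \<sigma> \<subseteq> \<tau> \<longrightarrow> \<tau> = \<sigma>)"

definition pure_complex :: "'a set \<Rightarrow> 'a set set \<Rightarrow> int \<Rightarrow> bool" where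
  "pure_complex V X d \<longleftrightarrow>
     abstract_complex V X \<and> (\<forall>\<sigma>. maximal_face X \<sigma> \<longrightarrow> face_dim \<sigma> = d)"

definition link :: "'a set set \<Rightarrow> 'a set \<Rightarrow> 'a set set" where
  "link X \<sigma> = {\<tau>\<in>X. \<tau> \<inter> \<sigma> = {} \<and> \<tau> \<union> \<sigma> \<in> X}"

definition weight :: "'a set set \<Rightarrow> 'a set \<Rightarrow> nat" where
  "weight X \<sigma> = card {\<tau> \<in> faces X (complex_dim X). \<sigma> \<subseteq> \<tau>}"

definition incidence :: "'a::linorder set \<Rightarrow> 'a set \<Rightarrow> real" where
  "incidence \<tau> \<sigma> = (-1) ^ card {v\<in>\<tau>. v < the_elem (\<tau> - \<sigma>)}"

text \<open>Matrices indexed by faces are realised as matrices indexed by natural numbers, through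
  one fixed enumeration of the \<open>k\<close>-dimensional faces. Another enumeration would conjugate the
  Laplacians below by a permutation matrix and leave their spectra unchanged.\<close>

definition face_list :: "'a set set \<Rightarrow> int \<Rightarrow> 'a set list" where
  "face_list X k = (SOME \<sigma>s. distinct \<sigma>s \<and> set \<sigma>s = faces X k)"

definition boundary_mat :: "'a::linorder set set \<Rightarrow> int \<Rightarrow> real mat" where
  "boundary_mat X k =
     mat (length (face_list X (k - 1))) (length (face_list X k))
       (\<lambda>(i, j). let \<sigma> = face_list X (k - 1) ! i; \<tau> = face_list X k ! j
                 in if \<sigma> \<subseteq> \<tau> then incidence \<tau> \<sigma> else 0)"

definition weight_mat :: "'a set set \<Rightarrow> int \<Rightarrow> real mat" where
  "weight_mat X k =
     mat_diag (length (face_list X k)) (\<lambda>i. real (weight X (face_list X k ! i)))"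

text \<open>In a pure complex every face lies in a face of top dimension, so the weights are positive
  and \<open>mat_inverse\<close> does return a matrix here.\<close>

definition weight_mat_inv :: "'a set set \<Rightarrow> int \<Rightarrow> real mat" where
  "weight_mat_inv X k = the (mat_inverse (weight_mat X k))"

definition weighted_laplacian :: "'a::linorder set set \<Rightarrow> int \<Rightarrow> real mat" where
  "weighted_laplacian X k =
     (let up = weight_mat_inv X k * boundary_mat X (k + 1) * weight_mat X (k + 1)
                 * transpose_mat (boundary_mat X (k + 1));
          down = transpose_mat (boundary_mat X k) * weight_mat_inv X (k - 1)
                 * boundary_mat X k * weight_mat X k
      in if k < complex_dim X then up + down else down)"

definition direct_sum_mat :: "('b \<Rightarrow> real mat) \<Rightarrow> 'b list \<Rightarrow> real mat" where
  "direct_sum_mat M \<eta>s = diag_block_mat (map M \<eta>s)"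

text \<open>The real eigenvalues in increasing order, each repeated according to its multiplicity as a
  root of the characteristic polynomial; for a matrix diagonalizable over the reals these are
  all the eigenvalues, and the multiplicities are the dimensions of the eigenspaces.
  The index starts at 1.\<close>

definition sorted_eigenvalues :: "real mat \<Rightarrow> real list" where
  "sorted_eigenvalues A = sorted_list_of_multiset (proots (char_poly A))"

definition nth_eigenvalue :: "nat \<Rightarrow> real mat \<Rightarrow> real" where
  "nth_eigenvalue i A = sorted_eigenvalues A ! (i - 1)"

lemma set_sorted_eigenvalues:
  assumes A: "A \<in> carrier_mat n n"
  shows "set (sorted_eigenvalues A) = {x. eigenvalue A x}"
proof -
  have "char_poly A \<noteq> 0"
    using degree_monic_char_poly[OF A] by auto
  then show ?thesis
    by (simp add: sorted_eigenvalues_def eigenvalue_root_char_poly[OF A])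
qed

end

theory Submission
  imports Defs
begin

text \<open>The matrix \<open>L\<^sub>k(X)\<close> is self-adjoint for the inner product with weights \<open>w\<close>, and its
  quadratic form is the sum of the squared weighted norms of the coboundary and of the boundary of a
  cochain \<open>f\<close>. For \<open>\<eta> \<in> X(l)\<close> let \<open>f\<^sub>\<eta>(\<alpha>) = \<plusminus> f(\<alpha> \<union> \<eta>)\<close> be the localization of \<open>f\<close> to the
  link of \<open>\<eta>\<close>. Since the weight of \<open>\<alpha>\<close> in the link is \<open>w(\<alpha> \<union> \<eta>)\<close>, counting the faces \<open>\<eta>\<close> inside a given
  face (or inside the intersection of two faces) gives
  \<open>\<Sum>\<^sub>\<eta> |f\<^sub>\<eta>|\<^sup>2 = C(k+1, l+1) |f|\<^sup>2\<close> and
  \<open>\<Sum>\<^sub>\<eta> Q\<^sub>\<eta>(f\<^sub>\<eta>) = C(k, l+1) Q(f) + C(k, l) (d-k) |f|\<^sup>2\<close>.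
  So \<open>f \<mapsto> (f\<^sub>\<eta>)\<^sub>\<eta>\<close> is a scaled isometric embedding relating the two quadratic forms, and the
  Courant-Fischer principle compares their \<open>i\<close>-th eigenvalues.\<close>

section \<open>Spectra of self-adjoint matrices\<close>

text \<open>Both localization identities are equalities. The inequality appears only in the
  comparison of eigenvalues: localization is injective but need not be onto, so just one direction
  survives. The two halves of the form behave differently. A face \<rho> containing \<eta> forces
  \<eta> into every face above \<rho>, so the boundary part is merely counted with multiplicity. The
  coboundary of a localized cochain at \<tau> sees only those k-faces of \<tau> that contain \<eta>;
  products of distinct values are then counted C(k, l+1) times but squares C(k+1, l+1) times. The
  excess C(k, l) is the source of the (d-k) term. Multiplying the second identity by (k+1)/C(k+1,
  l+1) turns its constants into k-l and (l+1)(d-k), and makes the scale of the embedding k+1. Since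
  eigenvalues are read off from real roots of the characteristic polynomial of a matrix that is not
  symmetric, a full list of real roots has to be secured before any variational argument.\<close>

lemma householder_reflection_exists:
  fixes v :: "real vec"
  assumes v: "v \<in> carrier_vec n" and n: "0 < n" and vv: "v \<bullet> v = 1"
  shows "\<exists>H \<in> carrier_mat n n. transpose_mat H = H \<and> H * H = 1\<^sub>m n \<and> H *\<^sub>v unit_vec n 0 = v"
proof (cases "v = unit_vec n 0")
  case True
  then show ?thesis
    by (intro bexI[of _ "1\<^sub>m n"]) auto
next
  case False
  \<comment> \<open>The vector u = e_0 - v is normal to the mirror that exchanges the unit vectors
    e_0 and v. It vanishes for v = e_0, which is why that case is separate.\<close>
  define u where "u i = (if i = 0 then 1 else 0) - v $ i" for i
  define s where "s = (\<Sum>i<n. u i * u i)"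
  have vv': "(\<Sum>i<n. v $ i * v $ i) = 1"
    using vv v by (auto simp: scalar_prod_def lessThan_atLeast0)
  \<comment> \<open>Because v has norm 1, |u|^2 = 2 - 2 v_0 = 2 u_0. Hence c u_0 = 1 below, and H
    e_0 = e_0 - u = v.\<close>
  have "s = (\<Sum>i<n. (if i = 0 then 1 - 2 * v $ i else 0) + v $ i * v $ i)"
    unfolding s_def u_def by (intro sum.cong) (auto simp: algebra_simps)
  also have "\<dots> = 2 * u 0"
    using n by (simp add: sum.distrib vv' sum.delta u_def)
  finally have s: "s = 2 * u 0" .
  have s0: "s \<noteq> 0"
  proof
    assume "s = 0"
    then have "\<forall>i<n. u i = 0"
      by (auto simp: s_def sum_nonneg_eq_0_iff)
    then have "v = unit_vec n 0"
      using v by (intro eq_vecI) (auto simp: u_def unit_vec_def)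
    with False show False by simp
  qed
  define c where "c = 2 / s"
  have cs: "c * s = 2" using s0 by (simp add: c_def)
  define H where "H = mat n n (\<lambda>(i,j). (if i = j then 1 else 0) - c * u i * u j)"
  have H: "H \<in> carrier_mat n n" by (simp add: H_def)
  have "transpose_mat H = H"
    by (rule eq_matI) (auto simp: H_def)
  moreover have "H * H = 1\<^sub>m n"
  proof (rule eq_matI)
    fix i j assume "i < dim_row (1\<^sub>m n :: real mat)" "j < dim_col (1\<^sub>m n :: real mat)"
    then have ij: "i < n" "j < n" by auto
    have "(H * H) $$ (i,j) = (\<Sum>k<n. H $$ (i,k) * H $$ (k,j))"
      using H ij by (auto simp: scalar_prod_def lessThan_atLeast0)
    also have "\<dots> = (\<Sum>k<n. (if k = i then (if i = j then 1 else 0) - c * u i * u j else 0)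
        + (if k = j then - c * u i * u j else 0) + (c * c * u i * u j) * (u k * u k))"
      using ij by (intro sum.cong) (auto simp: H_def algebra_simps)
    also have "\<dots> = (if i = j then 1 else 0) - 2 * c * u i * u j + (c * c * u i * u j) * s"
      using ij by (simp add: sum.distrib sum.delta s_def sum_distrib_left[symmetric])
    also have "\<dots> = (if i = j then 1 else 0) - 2 * c * u i * u j + (c * s) * (c * u i * u j)"
      by (simp add: algebra_simps)
    also have "\<dots> = (if i = j then 1 else 0)"
      by (simp add: cs)
    finally show "(H * H) $$ (i,j) = 1\<^sub>m n $$ (i,j)"
      using ij by simp
  qed (use H in auto)
  moreover have "H *\<^sub>v unit_vec n 0 = v"
  proof (rule eq_vecI)
    fix i assume "i < dim_vec v"
    then have i: "i < n" using v by auto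
    have "c * u 0 = 1" using cs s by simp
    then show "(H *\<^sub>v unit_vec n 0) $ i = v $ i"
      using i n H by (simp add: H_def u_def)
  qed (use H v in auto)
  ultimately show ?thesis using H by blast
qed

text \<open>The number v* S v is its own conjugate by symmetry, and it equals a |v|^2 with |v|^2 >
  0.\<close>

lemma eigenvalue_of_real_symmetric_is_real:
  fixes S :: "real mat" and a :: complex
  assumes S: "S \<in> carrier_mat n n" and sym: "transpose_mat S = S"
    and ev: "eigenvalue (map_mat complex_of_real S) a"
  shows "a \<in> \<real>"
proof -
  from ev S obtain v where v: "v \<in> carrier_vec n" "v \<noteq> 0\<^sub>v n"
    and av: "map_mat complex_of_real S *\<^sub>v v = a \<cdot>\<^sub>v v"
    by (auto simp: eigenvalue_def eigenvector_def)
  have Sij: "S $$ (i,j) = S $$ (j,i)" if "i < n" "j < n" for i j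
    using that S arg_cong[OF sym, of "\<lambda>M. M $$ (i,j)"] by auto
  have comp: "(\<Sum>j<n. complex_of_real (S $$ (i,j)) * v $ j) = a * v $ i" if "i < n" for i
    using that S v arg_cong[OF av, of "\<lambda>x. x $ i"]
    by (auto simp: scalar_prod_def lessThan_atLeast0)
  define q where "q = (\<Sum>i<n. \<Sum>j<n. complex_of_real (S $$ (i,j)) * cnj (v $ i) * v $ j)"
  define r where "r = (\<Sum>i<n. (cmod (v $ i))\<^sup>2)"
  have "q = (\<Sum>i<n. cnj (v $ i) * (\<Sum>j<n. complex_of_real (S $$ (i,j)) * v $ j))"
    by (simp add: q_def sum_distrib_left algebra_simps)
  also have "\<dots> = (\<Sum>i<n. a * of_real ((cmod (v $ i))\<^sup>2))"
  proof (rule sum.cong)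
    fix i assume "i \<in> {..<n}"
    then have "cnj (v $ i) * (\<Sum>j<n. complex_of_real (S $$ (i,j)) * v $ j) = a * (v $ i * cnj (v $ i))"
      by (simp add: comp)
    then show "cnj (v $ i) * (\<Sum>j<n. complex_of_real (S $$ (i,j)) * v $ j)
        = a * of_real ((cmod (v $ i))\<^sup>2)"
      unfolding complex_norm_square .
  qed simp
  finally have q: "q = a * of_real r"
    by (simp add: r_def sum_distrib_left)
  have "cnj q = (\<Sum>i<n. \<Sum>j<n. complex_of_real (S $$ (j,i)) * cnj (v $ j) * v $ i)"
    unfolding q_def by (auto intro!: sum.cong simp: Sij)
  also have "\<dots> = q"
    unfolding q_def by (rule sum.swap)
  finally have "cnj q = q" .
  obtain i where i: "i < n" "v $ i \<noteq> 0"
    using v by (metis carrier_vecD eq_vecI index_zero_vec)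
  then have "r > 0"
    unfolding r_def by (intro sum_pos2[of _ i]) auto
  with \<open>cnj q = q\<close> q have "cnj a = a" by simp
  then show ?thesis by (simp add: Reals_cnj_iff)
qed

text \<open>This guarantees that the list of real roots misses nothing. The polynomial splits over
  the complex numbers, its roots are real, and the factorization pulls back along the injective
  embedding of coefficients.\<close>

lemma char_poly_symmetric_splits:
  fixes S :: "real mat"
  assumes S: "S \<in> carrier_mat n n" and sym: "transpose_mat S = S"
  shows "char_poly S = (\<Prod>e\<leftarrow>sorted_eigenvalues S. [:- e, 1:])"
    and "length (sorted_eigenvalues S) = n"
proof -
  let ?C = "map_mat complex_of_real S"
  have C: "?C \<in> carrier_mat n n" using S by simp
  from char_poly_factorized[OF C] obtain as where
    as: "char_poly ?C = (\<Prod>a\<leftarrow>as. [:- a, 1:])" and len: "length as = n" by auto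
  have re: "complex_of_real (Re a) = a" if "a \<in> set as" for a
  proof -
    have "poly (char_poly ?C) a = 0"
      using that unfolding as by (auto simp: poly_prod_list prod_list_zero_iff)
    then have "eigenvalue ?C a"
      by (simp add: eigenvalue_root_char_poly[OF C])
    from eigenvalue_of_real_symmetric_is_real[OF S sym this] show ?thesis
      by (simp add: of_real_Re)
  qed
  interpret of_real_poly: map_poly_inj_comm_ring_hom complex_of_real ..
  define es where "es = map Re as"
  have "map_poly complex_of_real (char_poly S) = (\<Prod>a\<leftarrow>as. [:- a, 1:])"
    using as[unfolded of_real_hom.char_poly_hom[OF S]] .
  also have "\<dots> = map_poly complex_of_real (\<Prod>e\<leftarrow>es. [:- e, 1:])"
    using re unfolding es_def
    by (induct as) (simp_all add: o_def of_real_poly.hom_mult del: mult_pCons_left mult_pCons_right)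
  finally have es: "char_poly S = (\<Prod>e\<leftarrow>es. [:- e, 1:])"
    by simp
  have "proots (char_poly S) = mset es"
    unfolding es
  proof (induct es)
    case (Cons e es)
    have "(\<Prod>e\<leftarrow>es. [:- e, 1:]) \<noteq> 0"
      by (auto simp: prod_list_zero_iff)
    with Cons show ?case
      by (simp add: proots_mult del: mult_pCons_left mult_pCons_right)
  qed simp
  then have ms: "mset (sorted_eigenvalues S) = mset es"
    by (simp add: sorted_eigenvalues_def)
  from this show "length (sorted_eigenvalues S) = n"
    using len by (metis es_def length_map size_mset)
  show "char_poly S = (\<Prod>e\<leftarrow>sorted_eigenvalues S. [:- e, 1:])"
    unfolding es using ms by (metis mset_map prod_mset_prod_list)
qed

text \<open>A Householder reflection moving the first basis vector to a unit eigenvector splits off a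
  one-dimensional block; symmetry makes the remaining part of the first row vanish too.\<close>

lemma symmetric_orthogonal_diagonalization:
  fixes S :: "real mat"
  assumes "S \<in> carrier_mat n n" and "transpose_mat S = S"
    and "char_poly S = (\<Prod>e\<leftarrow>es. [:- e, 1:])"
  shows "\<exists>U \<in> carrier_mat n n. transpose_mat U * U = 1\<^sub>m n \<and> U * transpose_mat U = 1\<^sub>m n
    \<and> S = U * mat_diag n (\<lambda>i. es ! i) * transpose_mat U"
  using assms
\<comment> \<open>Induction on the list rather than on the size keeps the prescribed order of
  \<open>es\<close> on the diagonal. Cancelling the factor of \<open>e\<close> shows that the
  deflated block \<open>S2\<close> has characteristic polynomial given by the tail.\<close>
proof (induction es arbitrary: n S)
  case Nil
  then have "n = 0"
    using degree_monic_char_poly[OF Nil(1)] by simp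
  with Nil show ?case
    by (intro bexI[of _ "0\<^sub>m 0 0"]) auto
next
  case (Cons e es)
  note S = Cons.prems(1) and sym = Cons.prems(2) and cp = Cons.prems(3)
  define m where "m = length es"
  have n: "n = Suc m"
    using degree_monic_char_poly[OF S] degree_linear_factors[of uminus "e # es"]
    unfolding cp by (simp add: m_def)
  have "eigenvalue S e"
    unfolding eigenvalue_root_char_poly[OF S] cp by simp
  then obtain v0 where v0: "v0 \<in> carrier_vec n" "v0 \<noteq> 0\<^sub>v n" "S *\<^sub>v v0 = e \<cdot>\<^sub>v v0"
    using S by (auto simp: eigenvalue_def eigenvector_def)
  define r where "r = v0 \<bullet> v0"
  obtain i where i: "i < n" "v0 $ i \<noteq> 0"
    using v0 by (metis carrier_vecD eq_vecI index_zero_vec)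
  have r: "r > 0"
    unfolding r_def scalar_prod_def using i v0 by (intro sum_pos2[of _ i]) (auto simp: zero_less_mult_iff)
  define v where "v = (1 / sqrt r) \<cdot>\<^sub>v v0"
  have v: "v \<in> carrier_vec n" using v0 by (simp add: v_def)
  have vv: "v \<bullet> v = 1"
    using r v0 by (simp add: v_def r_def[symmetric] real_div_sqrt)
  have Sv: "S *\<^sub>v v = e \<cdot>\<^sub>v v"
    using v0 S by (simp add: v_def mult_mat_vec smult_smult_assoc mult.commute)
  obtain H where H: "H \<in> carrier_mat n n" and Hs: "transpose_mat H = H" and HH: "H * H = 1\<^sub>m n"
    and Hu: "H *\<^sub>v unit_vec n 0 = v"
    using householder_reflection_exists[OF v _ vv] n by auto
  define S' where "S' = H * S * H"
  have S': "S' \<in> carrier_mat n n" using H S by (simp add: S'_def)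
  have sym': "transpose_mat S' = S'"
    using H S by (simp add: S'_def transpose_mult[of _ n n _ n] Hs sym assoc_mult_mat[of _ n n _ n _ n])
  have Hv: "H *\<^sub>v v = unit_vec n 0"
    using H HH by (simp add: Hu[symmetric] assoc_mult_mat_vec[symmetric, of _ n n _ n])
  have "S' *\<^sub>v unit_vec n 0 = e \<cdot>\<^sub>v unit_vec n 0"
    using H S v by (simp add: S'_def assoc_mult_mat_vec[of _ n n _ n] Hu Sv mult_mat_vec[of _ n n] Hv)
  then have "(S' *\<^sub>v unit_vec n 0) $ i = (e \<cdot>\<^sub>v unit_vec n 0) $ i" for i
    by simp
  note ei = this
  have col0: "S' $$ (i, 0) = (if i = 0 then e else 0)" if "i < n" for i
    using that n S' ei[of i] by (simp add: scalar_prod_right_unit[of _ n] split: if_splits)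
  have S'ij: "S' $$ (i,j) = S' $$ (j,i)" if "i < n" "j < n" for i j
    using that S' arg_cong[OF sym', of "\<lambda>M. M $$ (i,j)"] by auto
  define S2 where "S2 = mat m m (\<lambda>(i,j). S' $$ (Suc i, Suc j))"
  define E where "E = mat 1 1 (\<lambda>_. e)"
  have S2: "S2 \<in> carrier_mat m m" and E: "E \<in> carrier_mat 1 1"
    by (simp_all add: S2_def E_def)
  have blk: "S' = four_block_mat E (0\<^sub>m 1 m) (0\<^sub>m m 1) S2"
  proof (rule eq_matI)
    fix i j
    assume "i < dim_row (four_block_mat E (0\<^sub>m 1 m) (0\<^sub>m m 1) S2)"
      "j < dim_col (four_block_mat E (0\<^sub>m 1 m) (0\<^sub>m m 1) S2)"
    then have "i < n" "j < n" using n S2 E by auto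
    then show "S' $$ (i,j) = four_block_mat E (0\<^sub>m 1 m) (0\<^sub>m m 1) S2 $$ (i,j)"
      using n col0 S'ij[of 0 j] by (cases i; cases j) (auto simp: S2_def E_def)
  qed (use n S' S2 E in auto)
  have symS2: "transpose_mat S2 = S2"
    by (rule eq_matI) (use n S'ij in \<open>auto simp: S2_def\<close>)
  have "similar_mat S' S"
    unfolding similar_mat_def similar_mat_wit_def Let_def using H S S' HH S'_def
    by (intro exI[of _ H]) auto
  then have "char_poly S' = char_poly S" by (rule char_poly_similar)
  moreover have "char_poly S' = char_poly E * char_poly S2"
    unfolding blk by (rule char_poly_four_block_zeros_col[OF E _ S2]) simp
  moreover have "char_poly E = [:- e, 1:]"
    by (subst char_poly_upper_triangular[OF E]) (auto simp: E_def diag_mat_def)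
  ultimately have "[:- e, 1:] * char_poly S2 = [:- e, 1:] * (\<Prod>e\<leftarrow>es. [:- e, 1:])"
    using cp by simp
  then have "char_poly S2 = (\<Prod>e\<leftarrow>es. [:- e, 1:])"
    by (metis mult_cancel_left one_neq_zero pCons_eq_0_iff)
  from Cons.IH[OF S2 symS2 this] obtain U2 where U2: "U2 \<in> carrier_mat m m"
    and U2a: "transpose_mat U2 * U2 = 1\<^sub>m m" and U2b: "U2 * transpose_mat U2 = 1\<^sub>m m"
    and S2eq: "S2 = U2 * mat_diag m (\<lambda>i. es ! i) * transpose_mat U2" by auto
  define B where "B = four_block_mat (1\<^sub>m 1) (0\<^sub>m 1 m) (0\<^sub>m m 1) U2"
  define D where "D = mat_diag n (\<lambda>i. (e # es) ! i)"
  have B: "B \<in> carrier_mat n n" unfolding B_def n using U2 by (intro carrier_matI) auto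
  have D: "D \<in> carrier_mat n n" by (simp add: D_def)
  have Bt: "transpose_mat B = four_block_mat (1\<^sub>m 1) (0\<^sub>m 1 m) (0\<^sub>m m 1) (transpose_mat U2)"
    unfolding B_def by (subst transpose_four_block_mat[of _ 1 1 _ m _ m]) (use U2 in auto)
  have Dblk: "D = four_block_mat E (0\<^sub>m 1 m) (0\<^sub>m m 1) (mat_diag m (\<lambda>i. es ! i))"
    by (rule eq_matI) (auto simp: D_def E_def mat_diag_def n nth_Cons' )
  have one: "four_block_mat (1\<^sub>m 1) (0\<^sub>m 1 m) (0\<^sub>m m 1) (1\<^sub>m m) = (1\<^sub>m n :: real mat)"
    by (rule eq_matI) (auto simp: n)
  have mult: "four_block_mat A1 (0\<^sub>m 1 m) (0\<^sub>m m 1) D1 * four_block_mat A2 (0\<^sub>m 1 m) (0\<^sub>m m 1) D2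
      = four_block_mat (A1 * A2) (0\<^sub>m 1 m) (0\<^sub>m m 1) (D1 * D2)"
    if "A1 \<in> carrier_mat 1 1" "A2 \<in> carrier_mat 1 1" "D1 \<in> carrier_mat m m" "D2 \<in> carrier_mat m m"
    for A1 A2 D1 D2 :: "real mat"
    using that by (subst mult_four_block_mat[of _ 1 1 _ m _ m _ _ 1 _ m]) auto
  have BB: "transpose_mat B * B = 1\<^sub>m n" "B * transpose_mat B = 1\<^sub>m n"
    unfolding Bt unfolding B_def using U2 U2a U2b one by (simp_all add: mult del: One_nat_def)
  have S'eq: "S' = B * D * transpose_mat B"
    unfolding Bt unfolding B_def Dblk blk using U2 E S2eq by (simp add: mult mult_carrier_mat[of _ m m _ m] del: One_nat_def)
  define U where "U = H * B"
  have U: "U \<in> carrier_mat n n" using H B by (simp add: U_def)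
  have Ut: "transpose_mat U = transpose_mat B * H"
    using H B by (simp add: U_def transpose_mult[of _ n n _ n] Hs)
  have tB: "transpose_mat B \<in> carrier_mat n n" using B by simp
  have "transpose_mat U * U = transpose_mat B * ((H * H) * B)"
    unfolding Ut unfolding U_def using H B tB by (simp add: assoc_mult_mat[of _ n n _ n _ n])
  then have 1: "transpose_mat U * U = 1\<^sub>m n" using HH BB B by simp
  have "U * transpose_mat U = H * ((B * transpose_mat B) * H)"
    unfolding Ut unfolding U_def using H B tB by (simp add: assoc_mult_mat[of _ n n _ n _ n])
  then have 2: "U * transpose_mat U = 1\<^sub>m n" using HH BB H by simp
  have "S = (H * H) * S * (H * H)" using HH S by simp
  also have "\<dots> = H * S' * H"
    unfolding S'_def using H S by (simp add: assoc_mult_mat[of _ n n _ n _ n])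
  also have "\<dots> = U * D * transpose_mat U"
    unfolding Ut unfolding U_def S'eq using H B tB D by (simp add: assoc_mult_mat[of _ n n _ n _ n])
  finally show ?case
    using U 1 2 unfolding D_def by blast
qed

section \<open>Matrices self-adjoint for a weighted inner product\<close>

text \<open>This is <x, M x> for the inner product with weights w. Vectors are plain functions on
  indices, so the values of a cochain along an enumeration of faces can be inserted
  directly.\<close>

definition weighted_form :: "nat \<Rightarrow> real mat \<Rightarrow> (nat \<Rightarrow> real) \<Rightarrow> (nat \<Rightarrow> real) \<Rightarrow> real" where
  "weighted_form n M w x = (\<Sum>i<n. \<Sum>j<n. w i * M $$ (i,j) * x i * x j)"

definition weighted_norm :: "nat \<Rightarrow> (nat \<Rightarrow> real) \<Rightarrow> (nat \<Rightarrow> real) \<Rightarrow> real" where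
  "weighted_norm n w x = (\<Sum>i<n. w i * (x i)\<^sup>2)"

text \<open>With W = diag(w), the last clause is symmetry of W M, that is <x, M y> = <M x,
  y>.\<close>

definition self_adjoint :: "nat \<Rightarrow> real mat \<Rightarrow> (nat \<Rightarrow> real) \<Rightarrow> bool" where
  "self_adjoint n M w \<longleftrightarrow> M \<in> carrier_mat n n \<and> (\<forall>i<n. w i > 0)
     \<and> (\<forall>i<n. \<forall>j<n. w i * M $$ (i,j) = w j * M $$ (j,i))"

text \<open>Conjugating by the diagonal matrix of the square roots of the weights reduces to the symmetric
  case. The functionals \<open>q k\<close> are the coordinates in an orthonormal eigenbasis whose vectors are
  the \<open>p s\<close>.\<close>

lemma self_adjoint_spectral:
  assumes sa: "self_adjoint n M w"
  shows "length (sorted_eigenvalues M) = n"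
    and "\<exists>p q. (\<forall>x. weighted_form n M w x
              = (\<Sum>k<n. sorted_eigenvalues M ! k * (\<Sum>i<n. q k i * x i)\<^sup>2))
          \<and> (\<forall>x. weighted_norm n w x = (\<Sum>k<n. (\<Sum>i<n. q k i * x i)\<^sup>2))
          \<and> (\<forall>k<n. \<forall>s<n. (\<Sum>i<n. q k i * p s i) = (if k = s then 1 else 0))"
proof -
  have M: "M \<in> carrier_mat n n" and w: "\<And>i. i < n \<Longrightarrow> w i > 0"
    and Mw: "\<And>i j. i < n \<Longrightarrow> j < n \<Longrightarrow> w i * M $$ (i,j) = w j * M $$ (j,i)"
    using sa by (auto simp: self_adjoint_def)
  define r where "r i = sqrt (w i)" for i
  have r: "r i > 0" "r i * r i = w i" if "i < n" for i
    using w[OF that] by (auto simp: r_def)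
  have r0: "r i \<noteq> 0" if "i < n" for i
    using r(1)[OF that] by simp
  define S where "S = mat n n (\<lambda>(i,j). r i * M $$ (i,j) / r j)"
  have S: "S \<in> carrier_mat n n" by (simp add: S_def)
  have "S = mat_diag n r * M * mat_diag n (\<lambda>i. 1 / r i)"
    using M by (auto simp: S_def mat_diag_mult_left[OF M] mat_diag_mult_right[of _ n n] intro!: eq_matI)
  moreover have "mat_diag n r * mat_diag n (\<lambda>i. 1 / r i) = 1\<^sub>m n"
    "mat_diag n (\<lambda>i. 1 / r i) * mat_diag n r = 1\<^sub>m n"
    unfolding mat_diag_diag using r0 by (auto simp: mat_diag_def intro!: eq_matI)
  ultimately have "similar_mat S M"
    using S M by (intro similar_matI[of _ _ "mat_diag n r" "mat_diag n (\<lambda>i. 1 / r i)" n]) auto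
  then have ev: "sorted_eigenvalues M = sorted_eigenvalues S"
    by (simp add: sorted_eigenvalues_def char_poly_similar)
  have "transpose_mat S = S"
  proof (rule eq_matI)
    fix i j assume "i < dim_row S" "j < dim_col S"
    then have ij: "i < n" "j < n" using S by auto
    have "(r j * r j) * M $$ (j,i) = (r i * r i) * M $$ (i,j)"
      using Mw[OF ij] r ij by simp
    then show "transpose_mat S $$ (i,j) = S $$ (i,j)"
      using ij r(1)[OF ij(1)] r(1)[OF ij(2)] by (simp add: S_def field_simps)
  qed (use S in auto)
  note sp = char_poly_symmetric_splits[OF S this]
  show "length (sorted_eigenvalues M) = n" unfolding ev by (rule sp)
  from symmetric_orthogonal_diagonalization[OF S \<open>transpose_mat S = S\<close> sp(1)] obtain U where
    U: "U \<in> carrier_mat n n" and U1: "transpose_mat U * U = 1\<^sub>m n"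
    and U2: "U * transpose_mat U = 1\<^sub>m n"
    and US: "S = U * mat_diag n (\<lambda>i. sorted_eigenvalues S ! i) * transpose_mat U"
    by auto
  let ?l = "\<lambda>i. sorted_eigenvalues S ! i"
  have o1: "(\<Sum>i<n. U $$ (i,k) * U $$ (i,s)) = (if k = s then 1 else 0)" if "k < n" "s < n" for k s
    using U that arg_cong[OF U1, of "\<lambda>A. A $$ (k,s)"]
    by (simp add: scalar_prod_def lessThan_atLeast0)
  have o2: "(\<Sum>k<n. U $$ (i,k) * U $$ (j,k)) = (if i = j then 1 else 0)" if "i < n" "j < n" for i j
    using U that arg_cong[OF U2, of "\<lambda>A. A $$ (i,j)"]
    by (simp add: scalar_prod_def lessThan_atLeast0)
  have Sij: "S $$ (i,j) = (\<Sum>k<n. ?l k * (U $$ (i,k) * U $$ (j,k)))" if "i < n" "j < n" for i j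
    using U that arg_cong[OF US, of "\<lambda>A. A $$ (i,j)"]
    by (simp add: mat_diag_mult_right[OF U] scalar_prod_def lessThan_atLeast0 mult_ac)
  \<comment> \<open>In matrix terms q is U^T R and p is R^-1 U with R = diag(r), so the two families
    are dual to each other.\<close>
  define q where "q k i = U $$ (i,k) * r i" for k i
  define p where "p s i = U $$ (i,s) / r i" for s i
  \<comment> \<open>The coefficients are kept arbitrary: the eigenvalues give the quadratic form,
    and the constant 1 gives the norm.\<close>
  have expand: "(\<Sum>k<n. c k * (\<Sum>i<n. q k i * x i)\<^sup>2)
      = (\<Sum>i<n. \<Sum>j<n. (\<Sum>k<n. c k * (U $$ (i,k) * U $$ (j,k))) * (r i * x i) * (r j * x j))"
    for c x :: "nat \<Rightarrow> real"
  proof -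
    have "(\<Sum>k<n. c k * (\<Sum>i<n. q k i * x i)\<^sup>2)
      = (\<Sum>k<n. \<Sum>i<n. \<Sum>j<n. c k * (U $$ (i,k) * U $$ (j,k)) * (r i * x i) * (r j * x j))"
      by (simp add: power2_eq_square sum_product sum_distrib_left q_def mult_ac)
    also have "\<dots> = (\<Sum>i<n. \<Sum>k<n. \<Sum>j<n. c k * (U $$ (i,k) * U $$ (j,k)) * (r i * x i) * (r j * x j))"
      by (rule sum.swap)
    also have "\<dots> = (\<Sum>i<n. \<Sum>j<n. \<Sum>k<n. c k * (U $$ (i,k) * U $$ (j,k)) * (r i * x i) * (r j * x j))"
      by (intro sum.cong refl sum.swap)
    finally show ?thesis by (simp add: sum_distrib_right)
  qed
  have "weighted_form n M w x = (\<Sum>k<n. ?l k * (\<Sum>i<n. q k i * x i)\<^sup>2)" for x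
    unfolding expand weighted_form_def
  proof (intro sum.cong refl)
    fix i j assume "i \<in> {..<n}" "j \<in> {..<n}"
    then have ij: "i < n" "j < n" by auto
    have "(r i * r i) * M $$ (i,j) * x i * x j = S $$ (i,j) * (r i * x i) * (r j * x j)"
      using ij r(1)[OF ij(2)] by (simp add: S_def)
    then show "w i * M $$ (i,j) * x i * x j
      = (\<Sum>k<n. ?l k * (U $$ (i,k) * U $$ (j,k))) * (r i * x i) * (r j * x j)"
      using ij r by (simp add: Sij)
  qed
  moreover have "weighted_norm n w x = (\<Sum>k<n. (\<Sum>i<n. q k i * x i)\<^sup>2)" for x
  proof -
    have "(\<Sum>k<n. (\<Sum>i<n. q k i * x i)\<^sup>2)
      = (\<Sum>i<n. \<Sum>j<n. (\<Sum>k<n. U $$ (i,k) * U $$ (j,k)) * (r i * x i) * (r j * x j))"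
      using expand[of "\<lambda>_. 1" x] by simp
    also have "\<dots> = (\<Sum>i<n. \<Sum>j<n. (if j = i then (r i * r i) * (x i)\<^sup>2 else 0))"
      by (intro sum.cong refl) (simp add: o2 power2_eq_square)
    also have "\<dots> = weighted_norm n w x"
      using r by (auto simp: weighted_norm_def intro!: sum.cong)
    finally show ?thesis by simp
  qed
  moreover have "(\<Sum>i<n. q k i * p s i) = (if k = s then 1 else 0)" if "k < n" "s < n" for k s
  proof -
    have "(\<Sum>i<n. q k i * p s i) = (\<Sum>i<n. U $$ (i,k) * U $$ (i,s))"
      using r0 by (intro sum.cong) (auto simp: q_def p_def)
    then show ?thesis using o1[OF that] by simp
  qed
  ultimately show "\<exists>p q. (\<forall>x. weighted_form n M w x
              = (\<Sum>k<n. sorted_eigenvalues M ! k * (\<Sum>i<n. q k i * x i)\<^sup>2))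
          \<and> (\<forall>x. weighted_norm n w x = (\<Sum>k<n. (\<Sum>i<n. q k i * x i)\<^sup>2))
          \<and> (\<forall>k<n. \<forall>s<n. (\<Sum>i<n. q k i * p s i) = (if k = s then 1 else 0))"
    unfolding ev by blast
qed

section \<open>Min-max comparison of two spectra\<close>

text \<open>A zero row pads the N equations in N + 1 unknowns to a square singular matrix; a kernel
  vector is the solution.\<close>

lemma underdetermined_system_nontrivial:
  fixes G :: "nat \<Rightarrow> nat \<Rightarrow> real"
  shows "\<exists>y. (\<exists>s\<le>N. y s \<noteq> 0) \<and> (\<forall>j<N. (\<Sum>s\<le>N. G j s * y s) = 0)"
proof -
  define A where "A = mat (Suc N) (Suc N) (\<lambda>(j,s). if j < N then G j s else 0)"
  have A: "A \<in> carrier_mat (Suc N) (Suc N)" by (simp add: A_def)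
  have "row A N = 0\<^sub>v (Suc N)"
    by (rule eq_vecI) (auto simp: A_def)
  then have "det A = 0"
    using laplace_expansion_row[OF A, of N] by (auto simp: A_def)
  then obtain v where v: "v \<in> carrier_vec (Suc N)" "v \<noteq> 0\<^sub>v (Suc N)" "A *\<^sub>v v = 0\<^sub>v (Suc N)"
    using det_0_iff_vec_prod_zero[OF A] by auto
  have "\<exists>s\<le>N. v $ s \<noteq> 0"
    using v(1,2) by (metis carrier_vecD eq_vecI index_zero_vec less_Suc_eq_le)
  moreover have "(\<Sum>s\<le>N. G j s * v $ s) = 0" if "j < N" for j
  proof -
    have "(A *\<^sub>v v) $ j = (\<Sum>s<Suc N. G j s * v $ s)"
      using that v(1) by (simp add: A_def scalar_prod_def atLeast0LessThan)
    then show ?thesis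
      using that by (simp add: v(3) lessThan_Suc_atMost)
  qed
  ultimately show ?thesis by blast
qed

text \<open>\<open>G\<close> is the matrix of a scaled isometry in eigenbasis coordinates. The span of the first
  \<open>N + 1\<close> source eigenvectors contains a nonzero vector whose image has no component along
  the first \<open>N\<close> target eigenvectors.\<close>

lemma min_max_comparison:
  fixes \<alpha> \<beta> :: "nat \<Rightarrow> real" and G :: "nat \<Rightarrow> nat \<Rightarrow> real"
  assumes \<alpha>: "\<And>i j. i \<le> j \<Longrightarrow> j < n \<Longrightarrow> \<alpha> i \<le> \<alpha> j"
    and \<beta>: "\<And>i j. i \<le> j \<Longrightarrow> j < m \<Longrightarrow> \<beta> i \<le> \<beta> j"
    and a: "0 \<le> a" and b: "0 \<le> b" and c: "0 < c"
    and norm: "\<And>y. (\<Sum>j<m. (\<Sum>s<n. G j s * y s)\<^sup>2) = c * (\<Sum>s<n. (y s)\<^sup>2)"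
    and form: "\<And>y. b * (\<Sum>j<m. \<beta> j * (\<Sum>s<n. G j s * y s)\<^sup>2) - e * (\<Sum>s<n. (y s)\<^sup>2)
                 \<le> a * (\<Sum>s<n. \<alpha> s * (y s)\<^sup>2)"
    and N: "N < n"
  shows "b * c * \<beta> N - e \<le> a * \<alpha> N"
proof -
  obtain y0 where y0: "\<exists>s\<le>N. y0 s \<noteq> 0" and G0: "\<And>j. j < N \<Longrightarrow> (\<Sum>s\<le>N. G j s * y0 s) = 0"
    using underdetermined_system_nontrivial[of N G] by auto
  define y where "y s = (if s \<le> N then y0 s else 0)" for s
  define z where "z j = (\<Sum>s<n. G j s * y s)" for j
  have z0: "z j = 0" if "j < N" for j
  proof -
    have "z j = (\<Sum>s\<le>N. G j s * y s)"
      unfolding z_def by (rule sum.mono_neutral_right) (use N in \<open>auto simp: y_def\<close>)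
    also have "\<dots> = 0" using G0[OF that] by (simp add: y_def)
    finally show ?thesis .
  qed
  define Y where "Y = (\<Sum>s<n. (y s)\<^sup>2)"
  have Y: "Y > 0"
  proof -
    obtain s where "s \<le> N" "y0 s \<noteq> 0" using y0 by auto
    then show ?thesis unfolding Y_def using N by (intro sum_pos2[of _ s]) (auto simp: y_def)
  qed
  have zY: "(\<Sum>j<m. (z j)\<^sup>2) = c * Y"
    unfolding z_def Y_def by (rule norm)
  \<comment> \<open>A scaled isometry is injective: if all m target coordinates were among the
    vanishing ones, the image of the nonzero y would be 0. This puts \<open>\<beta> N\<close> within
    range.\<close>
  have "N < m"
  proof (rule ccontr)
    assume "\<not> N < m"
    then have "(\<Sum>j<m. (z j)\<^sup>2) = 0" using z0 by (intro sum.neutral) auto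
    with zY Y c show False by simp
  qed
  \<comment> \<open>Only target indices j \<ge> N contribute, where \<open>\<beta> j\<close> is at
    least \<open>\<beta> N\<close>; below, only source indices s \<le> N contribute, where
    \<open>\<alpha> s\<close> is at most \<open>\<alpha> N\<close>.\<close>
  have "\<beta> N * (c * Y) \<le> (\<Sum>j<m. \<beta> j * (z j)\<^sup>2)"
    unfolding zY[symmetric] sum_distrib_left
  proof (rule sum_mono)
    fix j assume "j \<in> {..<m}"
    then show "\<beta> N * (z j)\<^sup>2 \<le> \<beta> j * (z j)\<^sup>2"
      using z0[of j] \<beta>[of N j] by (cases "j < N") (auto intro: mult_right_mono)
  qed
  then have "b * (\<beta> N * (c * Y)) \<le> b * (\<Sum>j<m. \<beta> j * (z j)\<^sup>2)"
    using b by (rule mult_left_mono)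
  moreover have "(\<Sum>s<n. \<alpha> s * (y s)\<^sup>2) \<le> \<alpha> N * Y"
    unfolding Y_def sum_distrib_left
  proof (rule sum_mono)
    fix s assume "s \<in> {..<n}"
    then show "\<alpha> s * (y s)\<^sup>2 \<le> \<alpha> N * (y s)\<^sup>2"
      using \<alpha>[of s N] N by (cases "s \<le> N") (auto intro: mult_right_mono simp: y_def)
  qed
  then have "a * (\<Sum>s<n. \<alpha> s * (y s)\<^sup>2) \<le> a * (\<alpha> N * Y)"
    using a by (rule mult_left_mono)
  moreover have "b * (\<Sum>j<m. \<beta> j * (z j)\<^sup>2) - e * Y \<le> a * (\<Sum>s<n. \<alpha> s * (y s)\<^sup>2)"
    unfolding z_def Y_def by (rule form)
  ultimately have "(b * c * \<beta> N - e) * Y \<le> a * \<alpha> N * Y"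
    by (simp add: algebra_simps)
  with Y show ?thesis by simp
qed

section \<open>Direct sums\<close>

text \<open>The vector counterpart of \<open>diag_block_mat\<close>: both recursions peel off the
  leading block, so they run in parallel. The value 0 past the last block only closes the
  recursion.\<close>

fun block_fun :: "('b \<Rightarrow> nat) \<Rightarrow> ('b \<Rightarrow> nat \<Rightarrow> real) \<Rightarrow> 'b list \<Rightarrow> nat \<Rightarrow> real" where
  "block_fun n x [] i = 0"
| "block_fun n x (h # hs) i = (if i < n h then x h i else block_fun n x hs (i - n h))"

lemma sum_lessThan_add:
  fixes g :: "nat \<Rightarrow> real"
  shows "(\<Sum>i<a + b. g i) = (\<Sum>i<a. g i) + (\<Sum>i<b. g (a + i))"
  by (induct b) (auto simp: add.assoc)

text \<open>Linearity in the blocks is what lets localization be written as a matrix in eigenbasis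
  coordinates.\<close>

lemma block_fun_linear:
  "block_fun n (\<lambda>h i. \<Sum>s\<in>S. y s * x s h i) hs i = (\<Sum>s\<in>S. y s * block_fun n (x s) hs i)"
  by (induct hs arbitrary: i) auto

lemma self_adjoint_diag_block_mat:
  fixes n :: "'b \<Rightarrow> nat" and M :: "'b \<Rightarrow> real mat" and w :: "'b \<Rightarrow> nat \<Rightarrow> real"
  assumes "\<And>h. h \<in> set hs \<Longrightarrow> self_adjoint (n h) (M h) (w h)"
  shows "self_adjoint (sum_list (map n hs)) (diag_block_mat (map M hs)) (block_fun n w hs)"
    and "weighted_form (sum_list (map n hs)) (diag_block_mat (map M hs)) (block_fun n w hs)
          (block_fun n x hs) = (\<Sum>h\<leftarrow>hs. weighted_form (n h) (M h) (w h) (x h))"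
    and "weighted_norm (sum_list (map n hs)) (block_fun n w hs) (block_fun n x hs)
          = (\<Sum>h\<leftarrow>hs. weighted_norm (n h) (w h) (x h))"
  using assms
proof (induct hs)
  case Nil
  { case 1 show ?case by (simp add: self_adjoint_def) }
  { case 2 show ?case by (simp add: weighted_form_def) }
  { case 3 show ?case by (simp add: weighted_norm_def) }
next
  case (Cons h hs)
  let ?N = "sum_list (map n hs)" and ?D = "diag_block_mat (map M hs)"
  have *: "self_adjoint (n h) (M h) (w h)" "self_adjoint ?N ?D (block_fun n w hs)"
    if "\<And>h'. h' \<in> set (h # hs) \<Longrightarrow> self_adjoint (n h') (M h') (w h')"
    using that Cons(1) by auto
  { case 1
    note * = *[OF 1]
    show ?case
      unfolding self_adjoint_def
    proof (intro conjI allI impI)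
      show "diag_block_mat (map M (h # hs)) \<in> carrier_mat (sum_list (map n (h # hs))) (sum_list (map n (h # hs)))"
        using * by (auto simp: self_adjoint_def Let_def)
    next
      fix i assume "i < sum_list (map n (h # hs))"
      then show "0 < block_fun n w (h # hs) i"
        using * by (auto simp: self_adjoint_def)
    next
      fix i j assume "i < sum_list (map n (h # hs))" "j < sum_list (map n (h # hs))"
      then show "block_fun n w (h # hs) i * diag_block_mat (map M (h # hs)) $$ (i, j)
        = block_fun n w (h # hs) j * diag_block_mat (map M (h # hs)) $$ (j, i)"
        using * by (auto simp: self_adjoint_def Let_def)
    qed }
  { case 2
    note * = *[OF 2]
    have d: "dim_row (M h) = n h" "dim_col (M h) = n h" "dim_row ?D = ?N" "dim_col ?D = ?N"
      using * by (auto simp: self_adjoint_def)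
    have "weighted_form (n h + ?N) (diag_block_mat (map M (h # hs))) (block_fun n w (h # hs))
          (block_fun n x (h # hs))
        = weighted_form (n h) (M h) (w h) (x h) + weighted_form ?N ?D (block_fun n w hs) (block_fun n x hs)"
      by (simp add: weighted_form_def sum_lessThan_add Let_def d)
    with Cons(2) 2 show ?case by (simp del: block_fun.simps diag_block_mat.simps) }
  { case 3
    show ?case using Cons(3) 3
      by (simp add: weighted_norm_def sum_lessThan_add) }
qed

section \<open>Faces and links of pure complexes\<close>

lemma pure_complex_finite:
  assumes "pure_complex V X d"
  shows "finite X" and "\<sigma> \<in> X \<Longrightarrow> finite \<sigma>" and "finite (faces X k)"
proof -
  have V: "finite V" "X \<subseteq> Pow V"
    using assms by (auto simp: pure_complex_def abstract_complex_def)
  then show "finite X" by (meson finite_Pow_iff finite_subset)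
  then show "finite (faces X k)" by (simp add: faces_def)
  show "finite \<sigma>" if "\<sigma> \<in> X"
    using V that by (meson PowD finite_subset subsetD)
qed

lemma pure_complex_subset:
  assumes "pure_complex V X d" "\<tau> \<in> X" "\<sigma> \<subseteq> \<tau>"
  shows "\<sigma> \<in> X"
  using assms by (auto simp: pure_complex_def abstract_complex_def)

lemma pure_complex_extend:
  assumes pc: "pure_complex V X d" and "\<sigma> \<in> X"
  shows "\<exists>T \<in> faces X d. \<sigma> \<subseteq> T"
proof -
  obtain T where "T \<in> X" "\<sigma> \<subseteq> T" "\<forall>\<tau>\<in>X. T \<subseteq> \<tau> \<longrightarrow> T = \<tau>"
    using finite_has_maximal2[OF pure_complex_finite(1)[OF pc] \<open>\<sigma> \<in> X\<close>] by blast
  moreover from this have "face_dim T = d"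
    using pc by (auto simp: pure_complex_def maximal_face_def)
  ultimately show ?thesis by (auto simp: faces_def)
qed

lemma pure_complex_face_dim_le:
  assumes pc: "pure_complex V X d" and "\<sigma> \<in> X"
  shows "face_dim \<sigma> \<le> d"
proof -
  obtain T where T: "T \<in> faces X d" "\<sigma> \<subseteq> T"
    using pure_complex_extend[OF assms] by auto
  then have "card \<sigma> \<le> card T"
    using pure_complex_finite(2)[OF pc] by (intro card_mono) (auto simp: faces_def)
  with T show ?thesis by (auto simp: faces_def face_dim_def)
qed

lemma complex_dim_pure:
  assumes pc: "pure_complex V X d"
  shows "complex_dim X = d"
  unfolding complex_dim_def
proof (rule Max_eqI)
  have "{} \<in> X" using pc by (auto simp: pure_complex_def abstract_complex_def)
  from pure_complex_extend[OF pc this] show "d \<in> face_dim ` X"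
    by (auto simp: faces_def)
qed (use pure_complex_finite[OF pc] pure_complex_face_dim_le[OF pc] in auto)

lemma weight_pure:
  assumes pc: "pure_complex V X d"
  shows "weight X \<sigma> = card {T \<in> faces X d. \<sigma> \<subseteq> T}"
  by (simp add: weight_def complex_dim_pure[OF pc])

lemma weight_pos:
  assumes pc: "pure_complex V X d" and "\<sigma> \<in> X"
  shows "0 < weight X \<sigma>"
  using pure_complex_extend[OF assms] pure_complex_finite(3)[OF pc, of d]
  by (auto simp: weight_pure[OF pc] card_gt_0_iff)

lemma faces_card: "\<sigma> \<in> faces X k \<Longrightarrow> int (card \<sigma>) = k + 1"
  by (simp add: faces_def face_dim_def)

text \<open>A maximal face \<tau> of the link lies together with \<eta> in a top face T of X. Then T
  - \<eta> is a face of the link containing \<tau>, hence equal to it, and its size is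
  determined.\<close>

lemma pure_complex_link:
  assumes pc: "pure_complex V X d" and \<eta>: "\<eta> \<in> X"
  shows "pure_complex V (link X \<eta>) (d - int (card \<eta>))"
  unfolding pure_complex_def
proof (intro conjI allI impI)
  show "abstract_complex V (link X \<eta>)"
    unfolding abstract_complex_def
  proof (intro conjI ballI allI impI)
    show "finite V" "link X \<eta> \<subseteq> Pow V"
      using pc by (auto simp: pure_complex_def abstract_complex_def link_def)
    show "{} \<in> link X \<eta>"
      using pc \<eta> by (simp add: pure_complex_def abstract_complex_def link_def)
    fix \<tau> \<sigma> assume "\<tau> \<in> link X \<eta>" "\<sigma> \<subseteq> \<tau>"
    then show "\<sigma> \<in> link X \<eta>"
      using pure_complex_subset[OF pc, of \<tau> \<sigma>] pure_complex_subset[OF pc, of "\<tau> \<union> \<eta>" "\<sigma> \<union> \<eta>"]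
      by (auto simp: link_def)
  qed
next
  fix \<tau> assume max: "maximal_face (link X \<eta>) \<tau>"
  then have \<tau>: "\<tau> \<in> X" "\<tau> \<inter> \<eta> = {}" "\<tau> \<union> \<eta> \<in> X"
    by (auto simp: maximal_face_def link_def)
  obtain T where T: "T \<in> faces X d" "\<tau> \<union> \<eta> \<subseteq> T"
    using pure_complex_extend[OF pc \<tau>(3)] by auto
  have "T \<in> X" using T by (simp add: faces_def)
  moreover have "T - \<eta> \<in> X" using \<open>T \<in> X\<close> by (rule pure_complex_subset[OF pc]) auto
  moreover have "(T - \<eta>) \<union> \<eta> = T" using T by auto
  ultimately have "T - \<eta> \<in> link X \<eta>" by (auto simp: link_def)
  moreover have "\<tau> \<subseteq> T - \<eta>" using T \<tau> by auto
  ultimately have "\<tau> = T - \<eta>" using max by (auto simp: maximal_face_def)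
  moreover have "card (T - \<eta>) + card \<eta> = card T"
    using T pure_complex_finite(2)[OF pc \<open>T \<in> X\<close>]
    by (metis card_Diff_subset card_mono finite_subset le_add_diff_inverse2 le_sup_iff)
  ultimately show "face_dim \<tau> = d - int (card \<eta>)"
    using faces_card[OF T(1)] by (simp add: face_dim_def)
qed

lemma faces_link:
  assumes pc: "pure_complex V X d" and \<eta>: "\<eta> \<in> X"
  shows "\<alpha> \<in> faces (link X \<eta>) j \<longleftrightarrow> \<alpha> \<inter> \<eta> = {} \<and> \<alpha> \<union> \<eta> \<in> faces X (j + int (card \<eta>))"
proof -
  have "\<alpha> \<in> X" if "\<alpha> \<union> \<eta> \<in> X"
    using that by (rule pure_complex_subset[OF pc]) auto
  moreover have "card (\<alpha> \<union> \<eta>) = card \<alpha> + card \<eta>" if "\<alpha> \<union> \<eta> \<in> X" "\<alpha> \<inter> \<eta> = {}"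
    using that pure_complex_finite(2)[OF pc that(1)] by (intro card_Un_disjoint) auto
  ultimately show ?thesis
    by (auto simp: faces_def link_def face_dim_def)
qed

lemma bij_betw_faces_link:
  assumes pc: "pure_complex V X d" and \<eta>: "\<eta> \<in> X"
  shows "bij_betw (\<lambda>\<alpha>. \<alpha> \<union> \<eta>) (faces (link X \<eta>) j) {\<sigma> \<in> faces X (j + int (card \<eta>)). \<eta> \<subseteq> \<sigma>}"
  by (rule bij_betwI[where g = "\<lambda>\<sigma>. \<sigma> - \<eta>"]) (auto simp: faces_link[OF assms] Un_absorb2)

text \<open>T \<mapsto> T \<union> \<eta> matches the top faces of the link above \<alpha> with the
  top faces of X above \<alpha> \<union> \<eta>.\<close>

lemma weight_link:
  assumes pc: "pure_complex V X d" and \<eta>: "\<eta> \<in> X" and \<alpha>: "\<alpha> \<inter> \<eta> = {}"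
  shows "weight (link X \<eta>) \<alpha> = weight X (\<alpha> \<union> \<eta>)"
proof -
  have "bij_betw (\<lambda>T. T \<union> \<eta>) {T \<in> faces (link X \<eta>) (d - int (card \<eta>)). \<alpha> \<subseteq> T}
      {T \<in> faces X d. \<alpha> \<union> \<eta> \<subseteq> T}"
    using \<alpha> by (intro bij_betwI[where g = "\<lambda>\<sigma>. \<sigma> - \<eta>"]) (auto simp: faces_link[OF pc \<eta>] Un_absorb2)
  then show ?thesis
    unfolding weight_pure[OF pc] weight_pure[OF pure_complex_link[OF pc \<eta>]]
    by (rule bij_betw_same_card)
qed

text \<open>The shift by l + 1 is the number of vertices of \<eta>, one more than its
  dimension.\<close>

lemma sum_faces_link:
  assumes pc: "pure_complex V X d" and \<eta>: "\<eta> \<in> faces X l"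
  shows "(\<Sum>\<alpha>\<in>faces (link X \<eta>) j. g (\<alpha> \<union> \<eta>)) = (\<Sum>\<sigma>\<in>{\<sigma>\<in>faces X (j + l + 1). \<eta> \<subseteq> \<sigma>}. g \<sigma>)"
proof -
  have "\<eta> \<in> X" "int (card \<eta>) = l + 1"
    using \<eta> faces_card[OF \<eta>] by (auto simp: faces_def)
  then show ?thesis
    using sum.reindex_bij_betw[OF bij_betw_faces_link[OF pc \<open>\<eta> \<in> X\<close>, of j], of g]
    by (simp add: add.assoc)
qed

section \<open>Quadratic forms of a cochain and of its localizations\<close>

text \<open>An entry of the boundary matrix, indexed by faces instead of positions. The smaller face
  comes first, whereas \<open>incidence\<close> takes the larger one first.\<close>

definition boundary_coeff :: "'a::linorder set \<Rightarrow> 'a set \<Rightarrow> real" where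
  "boundary_coeff \<sigma> \<tau> = (if \<sigma> \<subseteq> \<tau> then incidence \<tau> \<sigma> else 0)"

definition up_form :: "'a::linorder set set \<Rightarrow> int \<Rightarrow> ('a set \<Rightarrow> real) \<Rightarrow> real" where
  "up_form X k f = (\<Sum>\<tau>\<in>faces X (k + 1). real (weight X \<tau>) * (\<Sum>\<sigma>\<in>faces X k. boundary_coeff \<sigma> \<tau> * f \<sigma>)\<^sup>2)"

text \<open>The weighted adjoint of the coboundary has the value 1/w(\<rho>) times the inner sum at
  \<rho>. Its square, weighted by w(\<rho>), leaves a single division by w(\<rho>).\<close>

definition down_form :: "'a::linorder set set \<Rightarrow> int \<Rightarrow> ('a set \<Rightarrow> real) \<Rightarrow> real" where
  "down_form X k f = (\<Sum>\<rho>\<in>faces X (k - 1).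
     (\<Sum>\<sigma>\<in>faces X k. boundary_coeff \<rho> \<sigma> * real (weight X \<sigma>) * f \<sigma>)\<^sup>2 / real (weight X \<rho>))"

definition face_norm :: "'a set set \<Rightarrow> int \<Rightarrow> ('a set \<Rightarrow> real) \<Rightarrow> real" where
  "face_norm X k f = (\<Sum>\<sigma>\<in>faces X k. real (weight X \<sigma>) * (f \<sigma>)\<^sup>2)"

text \<open>The sign of the permutation that sorts the vertices of \<open>\<alpha>\<close> followed by those of \<open>\<eta>\<close>. It makes
  the incidence numbers of the link of \<open>\<eta>\<close> agree with those of the ambient complex.\<close>

definition link_sign :: "'a::linorder set \<Rightarrow> 'a set \<Rightarrow> real" where
  "link_sign \<eta> \<alpha> = (\<Prod>u\<in>\<alpha>. (-1) ^ card {v \<in> \<eta>. v < u})"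

definition localize :: "'a::linorder set \<Rightarrow> ('a set \<Rightarrow> real) \<Rightarrow> 'a set \<Rightarrow> real" where
  "localize \<eta> f \<alpha> = link_sign \<eta> \<alpha> * f (\<alpha> \<union> \<eta>)"

lemma link_sign_square [simp]: "link_sign \<eta> \<alpha> * link_sign \<eta> \<alpha> = 1"
  by (simp add: link_sign_def prod.distrib[symmetric] power_add[symmetric] mult_2[symmetric])

lemma link_sign_power2 [simp]: "(link_sign \<eta> \<alpha>)\<^sup>2 = 1"
  by (simp add: power2_eq_square)

lemma boundary_coeff_power2:
  "(boundary_coeff \<sigma> \<tau>)\<^sup>2 = (if \<sigma> \<subseteq> \<tau> then 1 else 0)"
  by (simp add: boundary_coeff_def incidence_def power_mult[symmetric])

text \<open>If u is the vertex of \<beta> outside \<alpha>, the vertices of \<beta> \<union> \<eta>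
  below u are those in \<beta> and those in \<eta>. The second group contributes exactly the factor
  by which \<open>link_sign\<close> changes from \<alpha> to \<beta>.\<close>

lemma boundary_coeff_link:
  assumes fin: "finite \<beta>" "finite \<eta>" and disj: "\<alpha> \<inter> \<eta> = {}" "\<beta> \<inter> \<eta> = {}"
    and card: "card \<beta> = Suc (card \<alpha>)"
  shows "boundary_coeff (\<alpha> \<union> \<eta>) (\<beta> \<union> \<eta>) = link_sign \<eta> \<alpha> * link_sign \<eta> \<beta> * boundary_coeff \<alpha> \<beta>"
proof (cases "\<alpha> \<subseteq> \<beta>")
  case False
  then have "\<not> \<alpha> \<union> \<eta> \<subseteq> \<beta> \<union> \<eta>" using disj by auto
  with False show ?thesis by (simp add: boundary_coeff_def)
next
  case True
  have "card (\<beta> - \<alpha>) = 1"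
    using True fin card by (simp add: card_Diff_subset finite_subset)
  then obtain u where u: "\<beta> - \<alpha> = {u}" by (auto simp: card_1_singleton_iff)
  then have \<beta>: "\<beta> = insert u \<alpha>" and u\<alpha>: "u \<notin> \<alpha>" using True by auto
  have u': "\<beta> \<union> \<eta> - (\<alpha> \<union> \<eta>) = {u}" using u disj by auto
  have "{v \<in> \<beta> \<union> \<eta>. v < u} = {v \<in> \<beta>. v < u} \<union> {v \<in> \<eta>. v < u}" by auto
  then have "card {v \<in> \<beta> \<union> \<eta>. v < u} = card {v \<in> \<beta>. v < u} + card {v \<in> \<eta>. v < u}"
    using fin disj by (simp only:) (intro card_Un_disjoint, auto)
  then have "incidence (\<beta> \<union> \<eta>) (\<alpha> \<union> \<eta>) = incidence \<beta> \<alpha> * (-1) ^ card {v \<in> \<eta>. v < u}"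
    by (simp add: incidence_def u u' power_add)
  moreover have "link_sign \<eta> \<beta> = (-1) ^ card {v \<in> \<eta>. v < u} * link_sign \<eta> \<alpha>"
    using fin u\<alpha> unfolding \<beta> link_sign_def by simp
  then have "link_sign \<eta> \<alpha> * link_sign \<eta> \<beta> = (link_sign \<eta> \<alpha> * link_sign \<eta> \<alpha>) * (-1) ^ card {v \<in> \<eta>. v < u}"
    by (simp only: mult_ac)
  then have "link_sign \<eta> \<alpha> * link_sign \<eta> \<beta> = (-1) ^ card {v \<in> \<eta>. v < u}"
    by simp
  moreover have "\<alpha> \<union> \<eta> \<subseteq> \<beta> \<union> \<eta>" using True by auto
  ultimately show ?thesis using True by (simp add: boundary_coeff_def)
qed

text \<open>Joining with \<eta> turns sums over the link into sums over faces of X containing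
  \<eta>. Of the two signs relating the boundary coefficients, one cancels against the sign in
  \<open>localize\<close>; the other is common to the inner sum and disappears on squaring.\<close>

lemma forms_link:
  assumes pc: "pure_complex V X d" and \<eta>: "\<eta> \<in> faces X l"
  shows "up_form (link X \<eta>) (k - l - 1) (localize \<eta> f)
      = (\<Sum>\<tau>\<in>{\<tau>\<in>faces X (k + 1). \<eta> \<subseteq> \<tau>}. real (weight X \<tau>) *
          (\<Sum>\<sigma>\<in>{\<sigma>\<in>faces X k. \<eta> \<subseteq> \<sigma>}. boundary_coeff \<sigma> \<tau> * f \<sigma>)\<^sup>2)" (is ?up)
    and "down_form (link X \<eta>) (k - l - 1) (localize \<eta> f)
      = (\<Sum>\<rho>\<in>{\<rho>\<in>faces X (k - 1). \<eta> \<subseteq> \<rho>}.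
          (\<Sum>\<sigma>\<in>faces X k. boundary_coeff \<rho> \<sigma> * real (weight X \<sigma>) * f \<sigma>)\<^sup>2 / real (weight X \<rho>))" (is ?down)
    and "face_norm (link X \<eta>) (k - l - 1) (localize \<eta> f)
      = (\<Sum>\<sigma>\<in>{\<sigma>\<in>faces X k. \<eta> \<subseteq> \<sigma>}. real (weight X \<sigma>) * (f \<sigma>)\<^sup>2)" (is ?norm)
proof -
  have \<eta>X: "\<eta> \<in> X" and \<eta>c: "int (card \<eta>) = l + 1"
    using \<eta> faces_card[OF \<eta>] by (auto simp: faces_def)
  let ?Y = "link X \<eta>"
  have fin\<eta>: "finite \<eta>" by (rule pure_complex_finite(2)[OF pc \<eta>X])
  have lk: "\<alpha> \<inter> \<eta> = {}" "finite \<alpha>" "weight ?Y \<alpha> = weight X (\<alpha> \<union> \<eta>)" "int (card \<alpha>) = j + 1"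
    if "\<alpha> \<in> faces ?Y j" for \<alpha> j
  proof -
    show "\<alpha> \<inter> \<eta> = {}" using that faces_link[OF pc \<eta>X] by auto
    then show "weight ?Y \<alpha> = weight X (\<alpha> \<union> \<eta>)" by (rule weight_link[OF pc \<eta>X])
    show "finite \<alpha>"
      using that by (intro pure_complex_finite(2)[OF pure_complex_link[OF pc \<eta>X]]) (auto simp: faces_def)
    show "int (card \<alpha>) = j + 1" by (rule faces_card[OF that])
  qed
  have bc: "boundary_coeff \<alpha> \<beta> * link_sign \<eta> \<alpha> = link_sign \<eta> \<beta> * boundary_coeff (\<alpha> \<union> \<eta>) (\<beta> \<union> \<eta>)"
    "boundary_coeff \<alpha> \<beta> * link_sign \<eta> \<beta> = link_sign \<eta> \<alpha> * boundary_coeff (\<alpha> \<union> \<eta>) (\<beta> \<union> \<eta>)"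
    if "\<alpha> \<in> faces ?Y j" "\<beta> \<in> faces ?Y (j + 1)" for \<alpha> \<beta> j
  proof -
    have "boundary_coeff (\<alpha> \<union> \<eta>) (\<beta> \<union> \<eta>) = link_sign \<eta> \<alpha> * link_sign \<eta> \<beta> * boundary_coeff \<alpha> \<beta>"
      using lk[OF that(1)] lk[OF that(2)] fin\<eta> by (intro boundary_coeff_link) auto
    then have "link_sign \<eta> \<beta> * boundary_coeff (\<alpha> \<union> \<eta>) (\<beta> \<union> \<eta>)
        = (link_sign \<eta> \<beta> * link_sign \<eta> \<beta>) * (link_sign \<eta> \<alpha> * boundary_coeff \<alpha> \<beta>)"
      "link_sign \<eta> \<alpha> * boundary_coeff (\<alpha> \<union> \<eta>) (\<beta> \<union> \<eta>)
        = (link_sign \<eta> \<alpha> * link_sign \<eta> \<alpha>) * (link_sign \<eta> \<beta> * boundary_coeff \<alpha> \<beta>)"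
      by (simp_all only: mult_ac)
    then show "boundary_coeff \<alpha> \<beta> * link_sign \<eta> \<alpha> = link_sign \<eta> \<beta> * boundary_coeff (\<alpha> \<union> \<eta>) (\<beta> \<union> \<eta>)"
      "boundary_coeff \<alpha> \<beta> * link_sign \<eta> \<beta> = link_sign \<eta> \<alpha> * boundary_coeff (\<alpha> \<union> \<eta>) (\<beta> \<union> \<eta>)"
      by simp_all
  qed
  have red: "(\<Sum>\<alpha>\<in>faces ?Y (k - l - 1). g (\<alpha> \<union> \<eta>)) = (\<Sum>\<sigma>\<in>{\<sigma>\<in>faces X k. \<eta> \<subseteq> \<sigma>}. g \<sigma>)" for g :: "'a set \<Rightarrow> real"
    using sum_faces_link[OF pc \<eta>, of g "k - l - 1"] by simp
  show ?norm
    unfolding face_norm_def red[symmetric]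
    by (intro sum.cong refl) (simp add: lk(3) localize_def power_mult_distrib)
  show ?up
  proof -
    have "up_form ?Y (k - l - 1) (localize \<eta> f) = (\<Sum>\<beta>\<in>faces ?Y (k - l). real (weight X (\<beta> \<union> \<eta>)) *
          (\<Sum>\<alpha>\<in>faces ?Y (k - l - 1). boundary_coeff (\<alpha> \<union> \<eta>) (\<beta> \<union> \<eta>) * f (\<alpha> \<union> \<eta>))\<^sup>2)"
      unfolding up_form_def
    proof (rule sum.cong)
      fix \<beta> assume \<beta>: "\<beta> \<in> faces ?Y (k - l)"
      have "(\<Sum>\<alpha>\<in>faces ?Y (k - l - 1). boundary_coeff \<alpha> \<beta> * localize \<eta> f \<alpha>)
          = link_sign \<eta> \<beta> * (\<Sum>\<alpha>\<in>faces ?Y (k - l - 1). boundary_coeff (\<alpha> \<union> \<eta>) (\<beta> \<union> \<eta>) * f (\<alpha> \<union> \<eta>))"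
        unfolding sum_distrib_left localize_def
        using \<beta> bc(1)[of _ "k - l - 1" \<beta>]
        by (intro sum.cong refl) (simp add: mult.assoc[symmetric])
      then show "real (weight ?Y \<beta>) * (\<Sum>\<alpha>\<in>faces ?Y (k - l - 1). boundary_coeff \<alpha> \<beta> * localize \<eta> f \<alpha>)\<^sup>2
        = real (weight X (\<beta> \<union> \<eta>)) *
          (\<Sum>\<alpha>\<in>faces ?Y (k - l - 1). boundary_coeff (\<alpha> \<union> \<eta>) (\<beta> \<union> \<eta>) * f (\<alpha> \<union> \<eta>))\<^sup>2"
        using \<beta> by (simp add: lk(3) power_mult_distrib)
    qed simp
    also have "\<dots> = (\<Sum>\<tau>\<in>{\<tau>\<in>faces X (k + 1). \<eta> \<subseteq> \<tau>}. real (weight X \<tau>) *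
          (\<Sum>\<sigma>\<in>{\<sigma>\<in>faces X k. \<eta> \<subseteq> \<sigma>}. boundary_coeff \<sigma> \<tau> * f \<sigma>)\<^sup>2)"
      unfolding red[of "\<lambda>\<sigma>. boundary_coeff \<sigma> (_ \<union> \<eta>) * f \<sigma>"]
      using sum_faces_link[OF pc \<eta>, of "\<lambda>\<tau>. real (weight X \<tau>) *
          (\<Sum>\<sigma>\<in>{\<sigma>\<in>faces X k. \<eta> \<subseteq> \<sigma>}. boundary_coeff \<sigma> \<tau> * f \<sigma>)\<^sup>2" "k - l"]
      by (simp add: add.commute)
    finally show ?thesis .
  qed
  show ?down
  proof -
    have "down_form ?Y (k - l - 1) (localize \<eta> f) = (\<Sum>\<rho>\<in>faces ?Y (k - l - 2).
          (\<Sum>\<alpha>\<in>faces ?Y (k - l - 1). boundary_coeff (\<rho> \<union> \<eta>) (\<alpha> \<union> \<eta>) * real (weight X (\<alpha> \<union> \<eta>)) * f (\<alpha> \<union> \<eta>))\<^sup>2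
          / real (weight X (\<rho> \<union> \<eta>)))"
      unfolding down_form_def
    proof (rule sum.cong)
      fix \<rho> assume \<rho>: "\<rho> \<in> faces ?Y (k - l - 2)"
      have "(\<Sum>\<alpha>\<in>faces ?Y (k - l - 1). boundary_coeff \<rho> \<alpha> * real (weight ?Y \<alpha>) * localize \<eta> f \<alpha>)
          = link_sign \<eta> \<rho> * (\<Sum>\<alpha>\<in>faces ?Y (k - l - 1).
              boundary_coeff (\<rho> \<union> \<eta>) (\<alpha> \<union> \<eta>) * real (weight X (\<alpha> \<union> \<eta>)) * f (\<alpha> \<union> \<eta>))"
        unfolding sum_distrib_left localize_def
      proof (intro sum.cong refl)
        fix \<alpha> assume \<alpha>: "\<alpha> \<in> faces ?Y (k - l - 1)"
        have "boundary_coeff \<rho> \<alpha> * real (weight ?Y \<alpha>) * (link_sign \<eta> \<alpha> * f (\<alpha> \<union> \<eta>))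
          = (boundary_coeff \<rho> \<alpha> * link_sign \<eta> \<alpha>) * real (weight X (\<alpha> \<union> \<eta>)) * f (\<alpha> \<union> \<eta>)"
          by (simp add: lk(3)[OF \<alpha>])
        also have "\<dots> = link_sign \<eta> \<rho> * (boundary_coeff (\<rho> \<union> \<eta>) (\<alpha> \<union> \<eta>) * real (weight X (\<alpha> \<union> \<eta>)) * f (\<alpha> \<union> \<eta>))"
          using bc(2)[OF \<rho>, of \<alpha>] \<alpha> by simp
        finally show "boundary_coeff \<rho> \<alpha> * real (weight ?Y \<alpha>) * (link_sign \<eta> \<alpha> * f (\<alpha> \<union> \<eta>))
          = link_sign \<eta> \<rho> * (boundary_coeff (\<rho> \<union> \<eta>) (\<alpha> \<union> \<eta>) * real (weight X (\<alpha> \<union> \<eta>)) * f (\<alpha> \<union> \<eta>))" .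
      qed
      then show "(\<Sum>\<alpha>\<in>faces ?Y (k - l - 1). boundary_coeff \<rho> \<alpha> * real (weight ?Y \<alpha>) * localize \<eta> f \<alpha>)\<^sup>2
            / real (weight ?Y \<rho>)
        = (\<Sum>\<alpha>\<in>faces ?Y (k - l - 1). boundary_coeff (\<rho> \<union> \<eta>) (\<alpha> \<union> \<eta>) * real (weight X (\<alpha> \<union> \<eta>)) * f (\<alpha> \<union> \<eta>))\<^sup>2
            / real (weight X (\<rho> \<union> \<eta>))"
        using \<rho> by (simp add: lk(3) power_mult_distrib)
    qed simp
    also have "\<dots> = (\<Sum>\<rho>\<in>{\<rho>\<in>faces X (k - 1). \<eta> \<subseteq> \<rho>}.
          (\<Sum>\<sigma>\<in>{\<sigma>\<in>faces X k. \<eta> \<subseteq> \<sigma>}. boundary_coeff \<rho> \<sigma> * real (weight X \<sigma>) * f \<sigma>)\<^sup>2 / real (weight X \<rho>))"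
      unfolding red[of "\<lambda>\<sigma>. boundary_coeff (_ \<union> \<eta>) \<sigma> * real (weight X \<sigma>) * f \<sigma>"]
      using sum_faces_link[OF pc \<eta>, of "\<lambda>\<rho>.
          (\<Sum>\<sigma>\<in>{\<sigma>\<in>faces X k. \<eta> \<subseteq> \<sigma>}. boundary_coeff \<rho> \<sigma> * real (weight X \<sigma>) * f \<sigma>)\<^sup>2 / real (weight X \<rho>)" "k - l - 2"]
      by simp
    also have "\<dots> = (\<Sum>\<rho>\<in>{\<rho>\<in>faces X (k - 1). \<eta> \<subseteq> \<rho>}.
          (\<Sum>\<sigma>\<in>faces X k. boundary_coeff \<rho> \<sigma> * real (weight X \<sigma>) * f \<sigma>)\<^sup>2 / real (weight X \<rho>))"
    proof (rule sum.cong)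
      fix \<rho> assume "\<rho> \<in> {\<rho>\<in>faces X (k - 1). \<eta> \<subseteq> \<rho>}"
      then have "(\<Sum>\<sigma>\<in>{\<sigma>\<in>faces X k. \<eta> \<subseteq> \<sigma>}. boundary_coeff \<rho> \<sigma> * real (weight X \<sigma>) * f \<sigma>)
        = (\<Sum>\<sigma>\<in>faces X k. boundary_coeff \<rho> \<sigma> * real (weight X \<sigma>) * f \<sigma>)"
        using pure_complex_finite(3)[OF pc]
        by (intro sum.mono_neutral_left) (auto simp: boundary_coeff_def)
      then show "(\<Sum>\<sigma>\<in>{\<sigma>\<in>faces X k. \<eta> \<subseteq> \<sigma>}. boundary_coeff \<rho> \<sigma> * real (weight X \<sigma>) * f \<sigma>)\<^sup>2 / real (weight X \<rho>)
        = (\<Sum>\<sigma>\<in>faces X k. boundary_coeff \<rho> \<sigma> * real (weight X \<sigma>) * f \<sigma>)\<^sup>2 / real (weight X \<rho>)"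
        by simp
    qed simp
    finally show ?thesis .
  qed
qed

section \<open>Localization to links\<close>

lemma card_subfaces:
  assumes pc: "pure_complex V X d" and \<sigma>: "\<sigma> \<in> X" and l: "-1 \<le> l"
  shows "card {\<eta> \<in> faces X l. \<eta> \<subseteq> \<sigma>} = card \<sigma> choose nat (l + 1)"
proof -
  have "{\<eta> \<in> faces X l. \<eta> \<subseteq> \<sigma>} = {\<eta>. \<eta> \<subseteq> \<sigma> \<and> card \<eta> = nat (l + 1)}"
    using l pure_complex_subset[OF pc \<sigma>] by (auto simp: faces_def face_dim_def)
  then show ?thesis
    using n_subsets[OF pure_complex_finite(2)[OF pc \<sigma>]] by simp
qed

text \<open>Double counting of pairs \<tau> \<subseteq> T with T a top face: each T above \<sigma>
  contains one such \<tau> for every vertex of T - \<sigma>, and there are d - k of these.\<close>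

lemma sum_weight_cofaces:
  assumes pc: "pure_complex V X d" and \<sigma>: "\<sigma> \<in> faces X k"
  shows "(\<Sum>\<tau>\<in>{\<tau>\<in>faces X (k + 1). \<sigma> \<subseteq> \<tau>}. real (weight X \<tau>)) = real_of_int (d - k) * real (weight X \<sigma>)"
proof -
  let ?A = "{\<tau>\<in>faces X (k + 1). \<sigma> \<subseteq> \<tau>}"
  note fin = pure_complex_finite(3)[OF pc]
  have c\<sigma>: "int (card \<sigma>) = k + 1" and f\<sigma>: "finite \<sigma>"
    using faces_card[OF \<sigma>] \<sigma> pure_complex_finite(2)[OF pc] by (auto simp: faces_def)
  have cnt: "real (card {\<tau> \<in> ?A. \<tau> \<subseteq> T}) = (if \<sigma> \<subseteq> T then real_of_int (d - k) else 0)"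
    if T: "T \<in> faces X d" for T
  proof (cases "\<sigma> \<subseteq> T")
    case True
    have TX: "T \<in> X" and fT: "finite T" and cT: "int (card T) = d + 1"
      using T pure_complex_finite(2)[OF pc] faces_card[OF T] by (auto simp: faces_def)
    have "{\<tau> \<in> ?A. \<tau> \<subseteq> T} = (\<lambda>u. insert u \<sigma>) ` (T - \<sigma>)"
    proof (intro equalityI subsetI)
      fix \<tau> assume "\<tau> \<in> {\<tau> \<in> ?A. \<tau> \<subseteq> T}"
      then have \<tau>: "\<tau> \<in> faces X (k + 1)" "\<sigma> \<subseteq> \<tau>" "\<tau> \<subseteq> T" by auto
      have "card (\<tau> - \<sigma>) = 1"
        using card_Diff_subset[OF f\<sigma> \<tau>(2)] faces_card[OF \<tau>(1)] c\<sigma> by simp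
      then obtain u where "\<tau> - \<sigma> = {u}" by (auto simp: card_1_singleton_iff)
      then have "\<tau> = insert u \<sigma>" "u \<in> T - \<sigma>" using \<tau> by auto
      then show "\<tau> \<in> (\<lambda>u. insert u \<sigma>) ` (T - \<sigma>)" by auto
    next
      fix \<tau> assume "\<tau> \<in> (\<lambda>u. insert u \<sigma>) ` (T - \<sigma>)"
      then obtain u where u: "u \<in> T" "u \<notin> \<sigma>" "\<tau> = insert u \<sigma>" by auto
      then have "\<tau> \<subseteq> T" using True by auto
      moreover have "\<tau> \<in> X" using TX \<open>\<tau> \<subseteq> T\<close> by (rule pure_complex_subset[OF pc])
      ultimately show "\<tau> \<in> {\<tau> \<in> ?A. \<tau> \<subseteq> T}"
        using u f\<sigma> c\<sigma> by (auto simp: faces_def face_dim_def)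
    qed
    moreover have "inj_on (\<lambda>u. insert u \<sigma>) (T - \<sigma>)"
      by (auto simp: inj_on_def)
    ultimately have "card {\<tau> \<in> ?A. \<tau> \<subseteq> T} = card (T - \<sigma>)" by (simp add: card_image)
    moreover have "int (card (T - \<sigma>)) = d - k"
      using True f\<sigma> fT card_mono[OF fT True] by (simp add: card_Diff_subset of_nat_diff cT c\<sigma>)
    ultimately show ?thesis using True by (metis of_int_of_nat_eq)
  next
    case False
    then have "{\<tau> \<in> ?A. \<tau> \<subseteq> T} = {}" by auto
    with False show ?thesis by (simp only: card.empty) simp
  qed
  have "(\<Sum>\<tau>\<in>?A. real (weight X \<tau>)) = (\<Sum>\<tau>\<in>?A. \<Sum>T\<in>{T \<in> faces X d. \<tau> \<subseteq> T}. 1)"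
    by (simp add: weight_pure[OF pc])
  also have "\<dots> = (\<Sum>T\<in>faces X d. \<Sum>\<tau>\<in>{\<tau> \<in> ?A. \<tau> \<subseteq> T}. 1)"
    by (rule sum.swap_restrict) (use fin in auto)
  also have "\<dots> = (\<Sum>T\<in>faces X d. if \<sigma> \<subseteq> T then real_of_int (d - k) else 0)"
    by (intro sum.cong refl) (use cnt in simp)
  also have "\<dots> = real_of_int (d - k) * real (weight X \<sigma>)"
    using fin by (simp add: sum.If_cases weight_pure[OF pc] Int_def)
  finally show ?thesis .
qed

text \<open>The number of l-dimensional subfaces depends only on the k + 1 vertices of the face.
  Used with k for the norm and with k - 1 for the down form, where it gives C(k, l+1).\<close>

lemma sum_faces_swap:
  fixes g :: "'a set \<Rightarrow> real"
  assumes pc: "pure_complex V X d" and l: "-1 \<le> l"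
  shows "(\<Sum>\<eta>\<in>faces X l. \<Sum>\<sigma>\<in>{\<sigma>\<in>faces X k. \<eta> \<subseteq> \<sigma>}. g \<sigma>)
    = real (nat (k + 1) choose nat (l + 1)) * (\<Sum>\<sigma>\<in>faces X k. g \<sigma>)"
proof -
  note fin = pure_complex_finite(3)[OF pc]
  have "(\<Sum>\<eta>\<in>faces X l. \<Sum>\<sigma>\<in>{\<sigma>\<in>faces X k. \<eta> \<subseteq> \<sigma>}. g \<sigma>)
      = (\<Sum>\<sigma>\<in>faces X k. \<Sum>\<eta>\<in>{\<eta>\<in>faces X l. \<eta> \<subseteq> \<sigma>}. g \<sigma>)"
    by (rule sum.swap_restrict) (use fin in auto)
  also have "\<dots> = (\<Sum>\<sigma>\<in>faces X k. real (nat (k + 1) choose nat (l + 1)) * g \<sigma>)"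
  proof (intro sum.cong refl)
    fix \<sigma> assume \<sigma>: "\<sigma> \<in> faces X k"
    then have "card \<sigma> = nat (k + 1)" "\<sigma> \<in> X" using faces_card[OF \<sigma>] by (auto simp: faces_def)
    then show "(\<Sum>\<eta>\<in>{\<eta>\<in>faces X l. \<eta> \<subseteq> \<sigma>}. g \<sigma>) = real (nat (k + 1) choose nat (l + 1)) * g \<sigma>"
      using card_subfaces[OF pc _ l, of \<sigma>] by simp
  qed
  finally show ?thesis by (simp add: sum_distrib_left)
qed

text \<open>After expanding the square, the product for \<sigma>, \<sigma>' is counted once for each
  l-face in \<sigma> \<inter> \<sigma>'. Distinct facets of \<tau> share k vertices, giving C(k,
  l+1); equal ones give C(k+1, l+1), which Pascal's rule splits into C(k, l+1) + C(k, l).\<close>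

lemma sum_square_over_subfaces:
  fixes c :: "'a set \<Rightarrow> real"
  assumes pc: "pure_complex V X d" and \<tau>: "\<tau> \<in> faces X (k + 1)" and k: "0 \<le> k" and l: "0 \<le> l"
    and c: "\<And>\<sigma>. \<not> \<sigma> \<subseteq> \<tau> \<Longrightarrow> c \<sigma> = 0"
  shows "(\<Sum>\<eta>\<in>{\<eta>\<in>faces X l. \<eta> \<subseteq> \<tau>}. (\<Sum>\<sigma>\<in>{\<sigma>\<in>faces X k. \<eta> \<subseteq> \<sigma>}. c \<sigma>)\<^sup>2)
    = real (nat k choose nat (l + 1)) * (\<Sum>\<sigma>\<in>faces X k. c \<sigma>)\<^sup>2
      + real (nat k choose nat l) * (\<Sum>\<sigma>\<in>faces X k. (c \<sigma>)\<^sup>2)"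
proof -
  note fin = pure_complex_finite(3)[OF pc]
  define F where "F = {\<sigma>\<in>faces X k. \<sigma> \<subseteq> \<tau>}"
  define H where "H = {\<eta>\<in>faces X l. \<eta> \<subseteq> \<tau>}"
  have F: "finite F" and H: "finite H" using fin by (auto simp: F_def H_def)
  have \<tau>X: "\<tau> \<in> X" and c\<tau>: "card \<tau> = nat k + 2" and f\<tau>: "finite \<tau>"
    using faces_card[OF \<tau>] \<tau> k pure_complex_finite(2)[OF pc] by (auto simp: faces_def)
  have cnt: "real (card {\<eta> \<in> H. \<eta> \<subseteq> \<sigma> \<and> \<eta> \<subseteq> \<sigma>'})
      = real (nat k choose nat (l + 1)) + (if \<sigma>' = \<sigma> then real (nat k choose nat l) else 0)"
    if \<sigma>: "\<sigma> \<in> F" and \<sigma>': "\<sigma>' \<in> F" for \<sigma> \<sigma>'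
  proof -
    have s: "\<sigma> \<subseteq> \<tau>" "\<sigma>' \<subseteq> \<tau>" "\<sigma> \<in> X" and cs: "card \<sigma> = nat k + 1" "card \<sigma>' = nat k + 1"
      using \<sigma> \<sigma>' k faces_card[of \<sigma> X k] faces_card[of \<sigma>' X k] by (auto simp: F_def faces_def)
    have fs: "finite \<sigma>" "finite \<sigma>'" using s f\<tau> finite_subset by auto
    have "{\<eta> \<in> H. \<eta> \<subseteq> \<sigma> \<and> \<eta> \<subseteq> \<sigma>'} = {\<eta> \<in> faces X l. \<eta> \<subseteq> \<sigma> \<inter> \<sigma>'}"
      using s by (auto simp: H_def)
    moreover have "\<sigma> \<inter> \<sigma>' \<in> X" using s(3) by (rule pure_complex_subset[OF pc]) auto
    ultimately have e: "card {\<eta> \<in> H. \<eta> \<subseteq> \<sigma> \<and> \<eta> \<subseteq> \<sigma>'} = card (\<sigma> \<inter> \<sigma>') choose nat (l + 1)"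
      using card_subfaces[OF pc, of "\<sigma> \<inter> \<sigma>'" l] l by simp
    show ?thesis
    proof (cases "\<sigma>' = \<sigma>")
      case True
      have "nat (l + 1) = Suc (nat l)" using l by simp
      then show ?thesis using True e cs by simp
    next
      case False
      \<comment> \<open>Two different facets cover \<tau>: their union has more than k + 1 and at
        most k + 2 vertices, so inclusion-exclusion leaves k in common.\<close>
      have "\<sigma> \<subset> \<sigma> \<union> \<sigma>'"
        using False cs fs by (metis card_subset_eq inf_sup_ord(3) psubsetI sup.cobounded2)
      then have "card \<sigma> < card (\<sigma> \<union> \<sigma>')" using fs by (intro psubset_card_mono) auto
      moreover have "card (\<sigma> \<union> \<sigma>') \<le> card \<tau>" using s f\<tau> by (intro card_mono) auto
      ultimately have "card (\<sigma> \<inter> \<sigma>') = nat k"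
        using card_Un_Int[OF fs] cs c\<tau> by simp
      then show ?thesis using e False by simp
    qed
  qed
  have toF: "(\<Sum>\<sigma>\<in>faces X k. g (c \<sigma>)) = (\<Sum>\<sigma>\<in>F. g (c \<sigma>))" if "g 0 = 0" for g :: "real \<Rightarrow> real"
    unfolding F_def using fin c that by (intro sum.mono_neutral_right) auto
  have "(\<Sum>\<eta>\<in>H. (\<Sum>\<sigma>\<in>{\<sigma>\<in>faces X k. \<eta> \<subseteq> \<sigma>}. c \<sigma>)\<^sup>2)
      = (\<Sum>\<eta>\<in>H. (\<Sum>\<sigma>\<in>F. if \<eta> \<subseteq> \<sigma> then c \<sigma> else 0)\<^sup>2)"
  proof (intro sum.cong refl)
    fix \<eta>
    have "(\<Sum>\<sigma>\<in>{\<sigma>\<in>faces X k. \<eta> \<subseteq> \<sigma>}. c \<sigma>) = (\<Sum>\<sigma>\<in>{\<sigma>\<in>F. \<eta> \<subseteq> \<sigma>}. c \<sigma>)"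
      unfolding F_def using fin c by (intro sum.mono_neutral_right) auto
    also have "\<dots> = (\<Sum>\<sigma>\<in>F. if \<eta> \<subseteq> \<sigma> then c \<sigma> else 0)"
      using F by (rule sum.inter_filter)
    finally show "(\<Sum>\<sigma>\<in>{\<sigma>\<in>faces X k. \<eta> \<subseteq> \<sigma>}. c \<sigma>)\<^sup>2 = (\<Sum>\<sigma>\<in>F. if \<eta> \<subseteq> \<sigma> then c \<sigma> else 0)\<^sup>2"
      by simp
  qed
  also have "\<dots> = (\<Sum>\<eta>\<in>H. \<Sum>\<sigma>\<in>F. \<Sum>\<sigma>'\<in>F. if \<eta> \<subseteq> \<sigma> \<and> \<eta> \<subseteq> \<sigma>' then c \<sigma> * c \<sigma>' else 0)"
    unfolding power2_eq_square sum_product by (intro sum.cong refl) auto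
  also have "\<dots> = (\<Sum>\<sigma>\<in>F. \<Sum>\<eta>\<in>H. \<Sum>\<sigma>'\<in>F. if \<eta> \<subseteq> \<sigma> \<and> \<eta> \<subseteq> \<sigma>' then c \<sigma> * c \<sigma>' else 0)"
    by (rule sum.swap)
  also have "\<dots> = (\<Sum>\<sigma>\<in>F. \<Sum>\<sigma>'\<in>F. \<Sum>\<eta>\<in>H. if \<eta> \<subseteq> \<sigma> \<and> \<eta> \<subseteq> \<sigma>' then c \<sigma> * c \<sigma>' else 0)"
    by (intro sum.cong refl sum.swap)
  also have "\<dots> = (\<Sum>\<sigma>\<in>F. \<Sum>\<sigma>'\<in>F. real (nat k choose nat (l + 1)) * (c \<sigma> * c \<sigma>')
      + (if \<sigma>' = \<sigma> then real (nat k choose nat l) * (c \<sigma>)\<^sup>2 else 0))"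
  proof (intro sum.cong refl)
    fix \<sigma> \<sigma>' assume "\<sigma> \<in> F" "\<sigma>' \<in> F"
    note cnt = cnt[OF this]
    have "(\<Sum>\<eta>\<in>H. if \<eta> \<subseteq> \<sigma> \<and> \<eta> \<subseteq> \<sigma>' then c \<sigma> * c \<sigma>' else 0)
        = real (card {\<eta> \<in> H. \<eta> \<subseteq> \<sigma> \<and> \<eta> \<subseteq> \<sigma>'}) * (c \<sigma> * c \<sigma>')"
      by (subst sum.inter_filter[OF H, symmetric]) simp
    then show "(\<Sum>\<eta>\<in>H. if \<eta> \<subseteq> \<sigma> \<and> \<eta> \<subseteq> \<sigma>' then c \<sigma> * c \<sigma>' else 0)
        = real (nat k choose nat (l + 1)) * (c \<sigma> * c \<sigma>')
          + (if \<sigma>' = \<sigma> then real (nat k choose nat l) * (c \<sigma>)\<^sup>2 else 0)"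
      unfolding cnt by (simp add: algebra_simps power2_eq_square)
  qed
  also have "\<dots> = real (nat k choose nat (l + 1)) * (\<Sum>\<sigma>\<in>F. c \<sigma>)\<^sup>2
      + real (nat k choose nat l) * (\<Sum>\<sigma>\<in>F. (c \<sigma>)\<^sup>2)"
    using F by (simp add: sum.distrib sum_distrib_left[symmetric] power2_eq_square sum_product)
  finally show ?thesis
    using toF[of "\<lambda>x. x"] toF[of "\<lambda>x. x\<^sup>2"] by (simp add: H_def)
qed

lemma sum_forms_links:
  fixes X :: "'a::linorder set set"
  assumes pc: "pure_complex V X d" and l: "0 \<le> l" and k: "0 \<le> k"
  shows "(\<Sum>\<eta>\<in>faces X l. face_norm (link X \<eta>) (k - l - 1) (localize \<eta> f))
      = real (nat (k + 1) choose nat (l + 1)) * face_norm X k f" (is ?norm)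
    and "(\<Sum>\<eta>\<in>faces X l. down_form (link X \<eta>) (k - l - 1) (localize \<eta> f))
      = real (nat k choose nat (l + 1)) * down_form X k f" (is ?down)
    and "(\<Sum>\<eta>\<in>faces X l. up_form (link X \<eta>) (k - l - 1) (localize \<eta> f))
      = real (nat k choose nat (l + 1)) * up_form X k f
        + real (nat k choose nat l) * (real_of_int (d - k) * face_norm X k f)" (is ?up)
proof -
  note fin = pure_complex_finite(3)[OF pc]
  have l': "-1 \<le> l" using l by simp
  show ?norm
    unfolding face_norm_def[of X] by (simp add: forms_link(3)[OF pc] sum_faces_swap[OF pc l'])
  show ?down
    unfolding down_form_def[of X] by (simp add: forms_link(2)[OF pc] sum_faces_swap[OF pc l'])
  let ?c = "\<lambda>\<tau> \<sigma>. boundary_coeff \<sigma> \<tau> * f \<sigma>"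
  have "(\<Sum>\<eta>\<in>faces X l. up_form (link X \<eta>) (k - l - 1) (localize \<eta> f))
      = (\<Sum>\<eta>\<in>faces X l. \<Sum>\<tau>\<in>{\<tau>\<in>faces X (k + 1). \<eta> \<subseteq> \<tau>}.
          real (weight X \<tau>) * (\<Sum>\<sigma>\<in>{\<sigma>\<in>faces X k. \<eta> \<subseteq> \<sigma>}. ?c \<tau> \<sigma>)\<^sup>2)"
    by (simp add: forms_link(1)[OF pc])
  also have "\<dots> = (\<Sum>\<tau>\<in>faces X (k + 1). \<Sum>\<eta>\<in>{\<eta>\<in>faces X l. \<eta> \<subseteq> \<tau>}.
          real (weight X \<tau>) * (\<Sum>\<sigma>\<in>{\<sigma>\<in>faces X k. \<eta> \<subseteq> \<sigma>}. ?c \<tau> \<sigma>)\<^sup>2)"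
    by (rule sum.swap_restrict) (use fin in auto)
  also have "\<dots> = (\<Sum>\<tau>\<in>faces X (k + 1). real (weight X \<tau>) *
          (real (nat k choose nat (l + 1)) * (\<Sum>\<sigma>\<in>faces X k. ?c \<tau> \<sigma>)\<^sup>2
            + real (nat k choose nat l) * (\<Sum>\<sigma>\<in>faces X k. (?c \<tau> \<sigma>)\<^sup>2)))"
  proof (intro sum.cong refl)
    fix \<tau> assume "\<tau> \<in> faces X (k + 1)"
    from sum_square_over_subfaces[OF pc this k l, of "?c \<tau>"]
    show "(\<Sum>\<eta>\<in>{\<eta>\<in>faces X l. \<eta> \<subseteq> \<tau>}.
          real (weight X \<tau>) * (\<Sum>\<sigma>\<in>{\<sigma>\<in>faces X k. \<eta> \<subseteq> \<sigma>}. ?c \<tau> \<sigma>)\<^sup>2)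
      = real (weight X \<tau>) *
          (real (nat k choose nat (l + 1)) * (\<Sum>\<sigma>\<in>faces X k. ?c \<tau> \<sigma>)\<^sup>2
            + real (nat k choose nat l) * (\<Sum>\<sigma>\<in>faces X k. (?c \<tau> \<sigma>)\<^sup>2))"
      by (simp add: sum_distrib_left[symmetric] boundary_coeff_def)
  qed
  also have "\<dots> = real (nat k choose nat (l + 1)) * up_form X k f
      + real (nat k choose nat l) * (\<Sum>\<tau>\<in>faces X (k + 1). real (weight X \<tau>) * (\<Sum>\<sigma>\<in>faces X k. (?c \<tau> \<sigma>)\<^sup>2))"
    unfolding up_form_def sum_distrib_left[of _ _ "faces X (k + 1)"] sum.distrib[symmetric]
    by (intro sum.cong refl) (simp add: distrib_left)
  \<comment> \<open>In the diagonal excess the signs square to 1. Exchanging the sums leaves, for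
    each \<sigma>, the square of f(\<sigma>) times the total weight of the cofaces of \<sigma>,
    which is (d - k) w(\<sigma>).\<close>
  also have "(\<Sum>\<tau>\<in>faces X (k + 1). real (weight X \<tau>) * (\<Sum>\<sigma>\<in>faces X k. (?c \<tau> \<sigma>)\<^sup>2))
      = (\<Sum>\<tau>\<in>faces X (k + 1). \<Sum>\<sigma>\<in>{\<sigma>\<in>faces X k. \<sigma> \<subseteq> \<tau>}. real (weight X \<tau>) * (f \<sigma>)\<^sup>2)"
  proof (intro sum.cong refl)
    fix \<tau>
    have "(\<Sum>\<sigma>\<in>faces X k. (?c \<tau> \<sigma>)\<^sup>2) = (\<Sum>\<sigma>\<in>faces X k. if \<sigma> \<subseteq> \<tau> then (f \<sigma>)\<^sup>2 else 0)"
      by (intro sum.cong refl) (simp add: power_mult_distrib boundary_coeff_power2)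
    also have "\<dots> = (\<Sum>\<sigma>\<in>{\<sigma>\<in>faces X k. \<sigma> \<subseteq> \<tau>}. (f \<sigma>)\<^sup>2)"
      using sum.inter_filter[OF fin] by (rule sym)
    finally show "real (weight X \<tau>) * (\<Sum>\<sigma>\<in>faces X k. (?c \<tau> \<sigma>)\<^sup>2)
        = (\<Sum>\<sigma>\<in>{\<sigma>\<in>faces X k. \<sigma> \<subseteq> \<tau>}. real (weight X \<tau>) * (f \<sigma>)\<^sup>2)"
      by (simp add: sum_distrib_left)
  qed
  also have "\<dots> = (\<Sum>\<sigma>\<in>faces X k. \<Sum>\<tau>\<in>{\<tau>\<in>faces X (k + 1). \<sigma> \<subseteq> \<tau>}. real (weight X \<tau>) * (f \<sigma>)\<^sup>2)"
    by (rule sum.swap_restrict) (use fin in auto)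
  also have "\<dots> = real_of_int (d - k) * face_norm X k f"
    unfolding face_norm_def sum_distrib_left
    by (intro sum.cong refl) (simp add: sum_distrib_right[symmetric] sum_weight_cofaces[OF pc])
  finally show ?up .
qed

section \<open>The weighted Laplacian as a quadratic form\<close>

lemma face_list_props:
  assumes "finite (faces X k)"
  shows "distinct (face_list X k)" and "set (face_list X k) = faces X k"
    and "length (face_list X k) = card (faces X k)"
proof -
  have "\<exists>\<sigma>s. distinct \<sigma>s \<and> set \<sigma>s = faces X k"
    using finite_distinct_list[OF assms] by auto
  from someI_ex[OF this] show *: "distinct (face_list X k)" "set (face_list X k) = faces X k"
    by (auto simp: face_list_def)
  from distinct_card[OF *(1)] *(2) show "length (face_list X k) = card (faces X k)" by simp
qed

lemma sum_face_list:
  fixes g :: "'a set \<Rightarrow> real"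
  assumes "finite (faces X k)"
  shows "(\<Sum>i<length (face_list X k). g (face_list X k ! i)) = (\<Sum>\<sigma>\<in>faces X k. g \<sigma>)"
  using sum.reindex_bij_betw[OF bij_betw_nth[OF face_list_props(1)[OF assms] refl refl], of g]
  by (simp add: face_list_props(2)[OF assms])

text \<open>\<open>the\<close> is meaningful only if \<open>mat_inverse\<close> succeeds. Positive
  weights make the diagonal of reciprocals a two-sided inverse, so the weight matrix is a unit;
  uniqueness of inverses then identifies the result.\<close>

lemma weight_mat_inv_pure:
  assumes pc: "pure_complex V X d"
  shows "weight_mat_inv X k
    = mat_diag (length (face_list X k)) (\<lambda>i. 1 / real (weight X (face_list X k ! i)))"
proof -
  let ?n = "length (face_list X k)"
  let ?W = "weight_mat X k" and ?J = "mat_diag ?n (\<lambda>i. 1 / real (weight X (face_list X k ! i)))"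
  have W: "?W \<in> carrier_mat ?n ?n" by (simp add: weight_mat_def)
  have mem: "face_list X k ! i \<in> X" if "i < ?n" for i
    using nth_mem[OF that] face_list_props(2)[OF pure_complex_finite(3)[OF pc]] by (auto simp: faces_def)
  have pos: "(weight X (face_list X k ! i) = 0) = False" if "i < ?n" for i
    using weight_pos[OF pc mem[OF that]] by simp
  have "?W * ?J = 1\<^sub>m ?n" "?J * ?W = 1\<^sub>m ?n"
    unfolding weight_mat_def mat_diag_diag by (auto simp: mat_diag_def pos intro!: eq_matI)
  note inv = this
  have "?W \<in> Units (ring_mat TYPE(real) ?n ())"
    unfolding Units_def ring_mat_def
    by (simp only: partial_object.simps monoid.simps mem_Collect_eq)
      (use W inv in \<open>intro conjI bexI[of _ ?J]; simp\<close>)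
  then obtain B where B: "mat_inverse ?W = Some B"
    using mat_inverse(1)[OF W, where b = "()"] by blast
  from mat_inverse(2)[OF W B] have "?W * B = 1\<^sub>m ?n" "B \<in> carrier_mat ?n ?n" by auto
  then have "B = (?J * ?W) * B" using inv by simp
  also have "\<dots> = ?J * (?W * B)"
    by (rule assoc_mult_mat[of _ ?n ?n _ ?n _ ?n]) (use W \<open>B \<in> _\<close> in auto)
  also have "\<dots> = ?J" unfolding \<open>?W * B = _\<close> by (rule right_mult_one_mat[of _ ?n ?n]) simp
  finally have "B = ?J" .
  with B show ?thesis by (simp add: weight_mat_inv_def)
qed

lemma weighted_laplacian_entry:
  assumes pc: "pure_complex V X d" and k: "k \<le> d"
    and i: "i < length (face_list X k)" and j: "j < length (face_list X k)"
  defines "\<sigma> \<equiv> face_list X k ! i" and "\<sigma>' \<equiv> face_list X k ! j"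
  shows "weighted_laplacian X k $$ (i, j)
    = (\<Sum>\<tau>\<in>faces X (k + 1). boundary_coeff \<sigma> \<tau> * real (weight X \<tau>) * boundary_coeff \<sigma>' \<tau>) / real (weight X \<sigma>)
      + (\<Sum>\<rho>\<in>faces X (k - 1). boundary_coeff \<rho> \<sigma> * boundary_coeff \<rho> \<sigma>' / real (weight X \<rho>)) * real (weight X \<sigma>')"
  (is "_ = ?u + ?d")
    and "weighted_laplacian X k \<in> carrier_mat (length (face_list X k)) (length (face_list X k))"
proof -
  note fin = pure_complex_finite(3)[OF pc]
  let ?n = "length (face_list X k)" and ?nu = "length (face_list X (k + 1))"
    and ?nd = "length (face_list X (k - 1))"
  define U where "U = weight_mat_inv X k * boundary_mat X (k + 1) * weight_mat X (k + 1)
                 * transpose_mat (boundary_mat X (k + 1))"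
  define D where "D = transpose_mat (boundary_mat X k) * weight_mat_inv X (k - 1)
                 * boundary_mat X k * weight_mat X k"
  have bu: "boundary_mat X (k + 1) = mat ?n ?nu
      (\<lambda>(i, j). boundary_coeff (face_list X k ! i) (face_list X (k + 1) ! j))"
    by (simp add: boundary_mat_def boundary_coeff_def Let_def)
  have bd: "boundary_mat X k = mat ?nd ?n
      (\<lambda>(i, j). boundary_coeff (face_list X (k - 1) ! i) (face_list X k ! j))"
    by (simp add: boundary_mat_def boundary_coeff_def Let_def)
  let ?W = "\<lambda>j t. real (weight X (face_list X j ! t))"
  let ?B = "mat ?n ?nu (\<lambda>(i, t). boundary_coeff (face_list X k ! i) (face_list X (k + 1) ! t) * ?W (k + 1) t / ?W k i)"
  let ?C = "mat ?n ?nd (\<lambda>(i, t). boundary_coeff (face_list X (k - 1) ! t) (face_list X k ! i) / ?W (k - 1) t)"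
  have "weight_mat_inv X k * boundary_mat X (k + 1) * weight_mat X (k + 1) = ?B"
    unfolding weight_mat_inv_pure[OF pc] weight_mat_def bu
    by (subst mat_diag_mult_left[of _ _ ?nu], simp, subst mat_diag_mult_right[of _ ?n], simp)
      (auto intro!: eq_matI)
  then have U_eq: "U = ?B * transpose_mat (boundary_mat X (k + 1))"
    by (simp only: U_def)
  have "transpose_mat (boundary_mat X k) * weight_mat_inv X (k - 1) = ?C"
    unfolding weight_mat_inv_pure[OF pc] bd
    by (subst mat_diag_mult_right[of _ ?n], simp) (auto intro!: eq_matI)
  then have D_eq: "D = mat ?n ?n (\<lambda>(i, j). (?C * boundary_mat X k) $$ (i, j) * ?W k j)"
    unfolding D_def weight_mat_def
    by (subst mat_diag_mult_right[of _ ?n]) (simp_all add: bd mult_carrier_mat[of _ ?n ?nd])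
  have U: "U \<in> carrier_mat ?n ?n" and D: "D \<in> carrier_mat ?n ?n"
    unfolding U_eq D_eq bu by (simp_all add: mult_carrier_mat[of _ ?n ?nu])
  have "U $$ (i, j) = (\<Sum>t<?nu. ?B $$ (i, t) * boundary_mat X (k + 1) $$ (j, t))"
    unfolding U_eq bu using i j by (simp add: scalar_prod_def atLeast0LessThan)
  also have "\<dots> = (\<Sum>t<?nu. (\<lambda>\<tau>. boundary_coeff \<sigma> \<tau> * real (weight X \<tau>) * boundary_coeff \<sigma>' \<tau> / real (weight X \<sigma>))
      (face_list X (k + 1) ! t))"
    unfolding bu using i j by (intro sum.cong refl) (simp add: \<sigma>_def \<sigma>'_def)
  also have "\<dots> = ?u"
    unfolding sum_divide_distrib by (rule sum_face_list[OF fin])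
  finally have Uij: "U $$ (i, j) = ?u" .
  have "D $$ (i, j) = (\<Sum>t<?nd. ?C $$ (i, t) * boundary_mat X k $$ (t, j)) * real (weight X \<sigma>')"
    unfolding D_eq bd using i j by (simp add: scalar_prod_def atLeast0LessThan \<sigma>'_def)
  also have "\<dots> = (\<Sum>t<?nd. (\<lambda>\<rho>. boundary_coeff \<rho> \<sigma> * boundary_coeff \<rho> \<sigma>' / real (weight X \<rho>))
      (face_list X (k - 1) ! t)) * real (weight X \<sigma>')"
    unfolding bd using i j by (intro arg_cong2[where f = "(*)"] sum.cong refl) (simp add: \<sigma>_def \<sigma>'_def)
  also have "\<dots> = ?d"
    by (rule arg_cong[where f = "\<lambda>x. x * _", OF sum_face_list[OF fin]])
  finally have Dij: "D $$ (i, j) = ?d" .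
  have L: "weighted_laplacian X k = (if k < d then U + D else D)"
    by (simp add: weighted_laplacian_def complex_dim_pure[OF pc] U_def D_def Let_def)
  then show "weighted_laplacian X k \<in> carrier_mat ?n ?n" using U D by simp
  show "weighted_laplacian X k $$ (i, j) = ?u + ?d"
  proof (cases "k < d")
    case True
    then show ?thesis using L U D i j Uij Dij by simp
  next
    case False
    \<comment> \<open>Here k = d. The definition omits the up part, and the formula agrees because
      its first sum is empty.\<close>
    then have "faces X (k + 1) = {}"
      using k by (force simp: faces_def dest: pure_complex_face_dim_le[OF pc])
    then show ?thesis using L Dij False by simp
  qed
qed

lemma weighted_laplacian_self_adjoint:
  fixes X :: "'a::linorder set set" and k :: int
  assumes pc: "pure_complex V X d" and k: "k \<le> d"
  defines "n \<equiv> length (face_list X k)" and "w \<equiv> \<lambda>i. real (weight X (face_list X k ! i))"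
  shows "self_adjoint n (weighted_laplacian X k) w"
    and "weighted_form n (weighted_laplacian X k) w (\<lambda>i. f (face_list X k ! i)) = up_form X k f + down_form X k f"
    and "weighted_norm n w (\<lambda>i. f (face_list X k ! i)) = face_norm X k f"
proof -
  note fin = pure_complex_finite(3)[OF pc]
  show "weighted_norm n w (\<lambda>i. f (face_list X k ! i)) = face_norm X k f"
    unfolding weighted_norm_def face_norm_def n_def w_def
    using sum_face_list[OF fin, where g = "\<lambda>\<sigma>. real (weight X \<sigma>) * (f \<sigma>)\<^sup>2"] .
  \<comment> \<open>The Laplacian entry multiplied by the row weight: this cancels the inverse
    weight of the up part and supplies the missing weight of the down part, so the result is
    symmetric in the two faces.\<close>
  let ?e = "\<lambda>\<sigma> \<sigma>'. (\<Sum>\<tau>\<in>faces X (k + 1). boundary_coeff \<sigma> \<tau> * real (weight X \<tau>) * boundary_coeff \<sigma>' \<tau>)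
      + (\<Sum>\<rho>\<in>faces X (k - 1). boundary_coeff \<rho> \<sigma> * boundary_coeff \<rho> \<sigma>' / real (weight X \<rho>))
        * real (weight X \<sigma>) * real (weight X \<sigma>')"
  have w: "w i > 0" if "i < n" for i
  proof -
    have "face_list X k ! i \<in> X"
      using nth_mem[OF that[unfolded n_def]] face_list_props(2)[OF fin] by (auto simp: faces_def)
    then show ?thesis using weight_pos[OF pc] by (simp add: w_def)
  qed
  have e: "w i * weighted_laplacian X k $$ (i, j) = ?e (face_list X k ! i) (face_list X k ! j)"
    if "i < n" "j < n" for i j
  proof -
    have cancel: "x * (a / x + b * y) = a + b * x * y" if "x > 0" for a b x y :: real
      using that by (simp add: distrib_left)
    show ?thesis
      unfolding weighted_laplacian_entry(1)[OF pc k that[unfolded n_def]] w_def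
      by (rule cancel) (use w[OF that(1)] in \<open>simp only: w_def\<close>)
  qed
  have sym: "?e \<sigma> \<sigma>' = ?e \<sigma>' \<sigma>" for \<sigma> \<sigma>'
    by (simp add: mult_ac)
  \<comment> \<open>The entry lemma yields the carrier only in the presence of valid indices, so an
    empty face list is treated by unfolding.\<close>
  have carr: "weighted_laplacian X k \<in> carrier_mat n n"
  proof (cases "n = 0")
    case True
    then show ?thesis
      by (auto simp: n_def weighted_laplacian_def Let_def boundary_mat_def weight_mat_def intro!: carrier_matI
          simp: weight_mat_inv_pure[OF pc] carrier_matD[OF mat_diag_dim])
  next
    case False
    then show ?thesis using weighted_laplacian_entry(2)[OF pc k, of 0 0] by (simp add: n_def)
  qed
  show "self_adjoint n (weighted_laplacian X k) w"
    unfolding self_adjoint_def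
  proof (intro conjI allI impI)
    fix i j assume ij: "i < n" "j < n"
    show "w i * weighted_laplacian X k $$ (i, j) = w j * weighted_laplacian X k $$ (j, i)"
      unfolding e[OF ij] e[OF ij(2,1)] by (rule sym)
  qed (use carr w in auto)
  have "weighted_form n (weighted_laplacian X k) w (\<lambda>i. f (face_list X k ! i))
      = (\<Sum>i<n. \<Sum>j<n. ?e (face_list X k ! i) (face_list X k ! j) * f (face_list X k ! i) * f (face_list X k ! j))"
    unfolding weighted_form_def by (intro sum.cong refl) (simp add: e)
  also have "\<dots> = (\<Sum>\<sigma>\<in>faces X k. \<Sum>\<sigma>'\<in>faces X k. ?e \<sigma> \<sigma>' * f \<sigma> * f \<sigma>')"
  proof -
    have "(\<Sum>j<n. ?e \<sigma> (face_list X k ! j) * f \<sigma> * f (face_list X k ! j))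
        = (\<Sum>\<sigma>'\<in>faces X k. ?e \<sigma> \<sigma>' * f \<sigma> * f \<sigma>')" for \<sigma>
      unfolding n_def by (rule sum_face_list[OF fin, where g = "\<lambda>\<sigma>'. ?e \<sigma> \<sigma>' * f \<sigma> * f \<sigma>'"])
    then show ?thesis
      unfolding n_def
      using sum_face_list[OF fin, where g = "\<lambda>\<sigma>. \<Sum>\<sigma>'\<in>faces X k. ?e \<sigma> \<sigma>' * f \<sigma> * f \<sigma>'"]
      by simp
  qed
  \<comment> \<open>Each entry is a sum of products of coefficients at a common \<tau> or \<rho>;
    moving that sum outermost produces the squares of the two forms.\<close>
  also have "\<dots> = (\<Sum>\<sigma>\<in>faces X k. \<Sum>\<sigma>'\<in>faces X k.
        \<Sum>\<tau>\<in>faces X (k + 1). real (weight X \<tau>) * (boundary_coeff \<sigma> \<tau> * f \<sigma>) * (boundary_coeff \<sigma>' \<tau> * f \<sigma>'))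
      + (\<Sum>\<sigma>\<in>faces X k. \<Sum>\<sigma>'\<in>faces X k. \<Sum>\<rho>\<in>faces X (k - 1).
          (boundary_coeff \<rho> \<sigma> * real (weight X \<sigma>) * f \<sigma>) * (boundary_coeff \<rho> \<sigma>' * real (weight X \<sigma>') * f \<sigma>') / real (weight X \<rho>))"
    unfolding sum.distrib[symmetric] distrib_right sum_distrib_right
    by (intro sum.cong refl arg_cong2[where f = "(+)"]) simp_all
  also have "(\<Sum>\<sigma>\<in>faces X k. \<Sum>\<sigma>'\<in>faces X k.
        \<Sum>\<tau>\<in>faces X (k + 1). real (weight X \<tau>) * (boundary_coeff \<sigma> \<tau> * f \<sigma>) * (boundary_coeff \<sigma>' \<tau> * f \<sigma>'))
      = up_form X k f"
  proof -
    have "up_form X k f = (\<Sum>\<tau>\<in>faces X (k + 1). \<Sum>\<sigma>\<in>faces X k. \<Sum>\<sigma>'\<in>faces X k.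
        real (weight X \<tau>) * (boundary_coeff \<sigma> \<tau> * f \<sigma>) * (boundary_coeff \<sigma>' \<tau> * f \<sigma>'))"
      unfolding up_form_def power2_eq_square sum_product by (simp add: sum_distrib_left mult_ac)
    also have "\<dots> = (\<Sum>\<sigma>\<in>faces X k. \<Sum>\<tau>\<in>faces X (k + 1). \<Sum>\<sigma>'\<in>faces X k.
        real (weight X \<tau>) * (boundary_coeff \<sigma> \<tau> * f \<sigma>) * (boundary_coeff \<sigma>' \<tau> * f \<sigma>'))"
      by (rule sum.swap)
    also have "\<dots> = (\<Sum>\<sigma>\<in>faces X k. \<Sum>\<sigma>'\<in>faces X k. \<Sum>\<tau>\<in>faces X (k + 1).
        real (weight X \<tau>) * (boundary_coeff \<sigma> \<tau> * f \<sigma>) * (boundary_coeff \<sigma>' \<tau> * f \<sigma>'))"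
      by (intro sum.cong refl sum.swap)
    finally show ?thesis by simp
  qed
  also have "(\<Sum>\<sigma>\<in>faces X k. \<Sum>\<sigma>'\<in>faces X k. \<Sum>\<rho>\<in>faces X (k - 1).
          (boundary_coeff \<rho> \<sigma> * real (weight X \<sigma>) * f \<sigma>) * (boundary_coeff \<rho> \<sigma>' * real (weight X \<sigma>') * f \<sigma>') / real (weight X \<rho>))
      = down_form X k f"
  proof -
    have "down_form X k f = (\<Sum>\<rho>\<in>faces X (k - 1). \<Sum>\<sigma>\<in>faces X k. \<Sum>\<sigma>'\<in>faces X k.
          (boundary_coeff \<rho> \<sigma> * real (weight X \<sigma>) * f \<sigma>) * (boundary_coeff \<rho> \<sigma>' * real (weight X \<sigma>') * f \<sigma>') / real (weight X \<rho>))"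
      by (simp add: down_form_def power2_eq_square sum_product sum_divide_distrib)
    also have "\<dots> = (\<Sum>\<sigma>\<in>faces X k. \<Sum>\<rho>\<in>faces X (k - 1). \<Sum>\<sigma>'\<in>faces X k.
          (boundary_coeff \<rho> \<sigma> * real (weight X \<sigma>) * f \<sigma>) * (boundary_coeff \<rho> \<sigma>' * real (weight X \<sigma>') * f \<sigma>') / real (weight X \<rho>))"
      by (rule sum.swap)
    also have "\<dots> = (\<Sum>\<sigma>\<in>faces X k. \<Sum>\<sigma>'\<in>faces X k. \<Sum>\<rho>\<in>faces X (k - 1).
          (boundary_coeff \<rho> \<sigma> * real (weight X \<sigma>) * f \<sigma>) * (boundary_coeff \<rho> \<sigma>' * real (weight X \<sigma>') * f \<sigma>') / real (weight X \<rho>))"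
      by (intro sum.cong refl sum.swap)
    finally show ?thesis by simp
  qed
  finally show "weighted_form n (weighted_laplacian X k) w (\<lambda>i. f (face_list X k ! i)) = up_form X k f + down_form X k f" .
qed

section \<open>Comparison of the eigenvalues\<close>

lemma sorted_eigenvalues_nth_mono:
  "i \<le> j \<Longrightarrow> j < length (sorted_eigenvalues A) \<Longrightarrow> sorted_eigenvalues A ! i \<le> sorted_eigenvalues A ! j"
  by (simp add: sorted_eigenvalues_def sorted_nth_mono)

text \<open>The normalization (k+1)/C(k+1, l+1) converts the counting constants into those of the
  theorem. The first ratio is the absorption identity (k+1) C(k, l) = (l+1) C(k+1, l+1); the second
  follows from it by Pascal's rule.\<close>

lemma choose_ratios:
  fixes k l :: int
  assumes "0 \<le> l" "l < k"
  defines "c \<equiv> real (nat (k + 1) choose nat (l + 1))"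
  shows "c > 0"
    and "real_of_int (k + 1) / c * real (nat k choose nat l) = real_of_int (l + 1)"
    and "real_of_int (k + 1) / c * real (nat k choose nat (l + 1)) = real_of_int (k - l)"
proof -
  obtain m n where mn: "l = int m" "k = int n"
    using assms by (metis nonneg_int_cases order.strict_implies_order order_trans)
  have c: "c = real (Suc n choose Suc m)"
    unfolding c_def mn by (simp add: nat_add_distrib)
  show "c > 0" using assms(2) mn by (simp add: c del: binomial_Suc_Suc)
  have e: "real (Suc n) * real (n choose m) = c * real (Suc m)"
    unfolding c using Suc_times_binomial_eq[of n m] by (metis of_nat_mult)
  have "c = real (n choose m) + real (n choose Suc m)"
    unfolding c by simp
  then have e2: "real (Suc n) * real (n choose Suc m) = c * (real n - real m)"
    using e by (simp add: algebra_simps)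
  show "real_of_int (k + 1) / c * real (nat k choose nat l) = real_of_int (l + 1)"
    using e \<open>c > 0\<close> by (simp add: mn field_simps)
  have "nat (l + 1) = Suc m" by (simp add: mn)
  then show "real_of_int (k + 1) / c * real (nat k choose nat (l + 1)) = real_of_int (k - l)"
    using e2 \<open>c > 0\<close> by (simp add: mn field_simps)
qed

theorem theorem1p3:
  fixes V :: "'a::linorder set" and X :: "'a set set" and d k l :: int and i :: nat
  assumes "pure_complex V X d"
    and "0 \<le> l" and "l < k" and "k \<le> d"
    and "1 \<le> i" and "i \<le> card (faces X k)"
  shows "real_of_int (k - l) * nth_eigenvalue i (weighted_laplacian X k)
    \<ge> real_of_int (k + 1) *
        nth_eigenvalue i
          (direct_sum_mat (\<lambda>\<eta>. weighted_laplacian (link X \<eta>) (k - l - 1)) (face_list X l))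
      - real_of_int ((l + 1) * (d - k))"
proof -
  note pc = assms(1) and l = assms(2) and lk = assms(3) and kd = assms(4)
  note fin = pure_complex_finite(3)[OF pc]
  define A where "A = weighted_laplacian X k"
  define n where "n = length (face_list X k)"
  define w where "w = (\<lambda>i. real (weight X (face_list X k ! i)))"
  have A: "self_adjoint n A w"
    and A_form: "\<And>f. weighted_form n A w (\<lambda>i. f (face_list X k ! i)) = up_form X k f + down_form X k f"
    and A_norm: "\<And>f. weighted_norm n w (\<lambda>i. f (face_list X k ! i)) = face_norm X k f"
    unfolding A_def n_def w_def using weighted_laplacian_self_adjoint[OF pc kd] by auto
  define hs where "hs = face_list X l"
  define M where "M = (\<lambda>\<eta>. weighted_laplacian (link X \<eta>) (k - l - 1))"
  define fl where "fl \<eta> = face_list (link X \<eta>) (k - l - 1)" for \<eta>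
  define n' where "n' \<eta> = length (fl \<eta>)" for \<eta>
  define w' where "w' \<eta> = (\<lambda>i. real (weight (link X \<eta>) (fl \<eta> ! i)))" for \<eta>
  have hs: "distinct hs" "set hs = faces X l"
    using face_list_props[OF fin] by (auto simp: hs_def)
  have M: "self_adjoint (n' \<eta>) (M \<eta>) (w' \<eta>)"
    and M_form: "\<And>f. weighted_form (n' \<eta>) (M \<eta>) (w' \<eta>) (\<lambda>i. f (fl \<eta> ! i))
      = up_form (link X \<eta>) (k - l - 1) f + down_form (link X \<eta>) (k - l - 1) f"
    and M_norm: "\<And>f. weighted_norm (n' \<eta>) (w' \<eta>) (\<lambda>i. f (fl \<eta> ! i))
      = face_norm (link X \<eta>) (k - l - 1) f"
    if \<eta>: "\<eta> \<in> set hs" for \<eta>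
  proof -
    have "\<eta> \<in> X" "int (card \<eta>) = l + 1"
      using \<eta> hs faces_card[of \<eta> X l] by (auto simp: faces_def)
    with pure_complex_link[OF pc] have "pure_complex V (link X \<eta>) (d - l - 1)"
      by (metis diff_diff_eq)
    note * = weighted_laplacian_self_adjoint[OF this, of "k - l - 1"]
    show "self_adjoint (n' \<eta>) (M \<eta>) (w' \<eta>)"
      "\<And>f. weighted_form (n' \<eta>) (M \<eta>) (w' \<eta>) (\<lambda>i. f (fl \<eta> ! i))
        = up_form (link X \<eta>) (k - l - 1) f + down_form (link X \<eta>) (k - l - 1) f"
      "\<And>f. weighted_norm (n' \<eta>) (w' \<eta>) (\<lambda>i. f (fl \<eta> ! i))
        = face_norm (link X \<eta>) (k - l - 1) f"
      unfolding n'_def M_def w'_def fl_def using * kd by auto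
  qed
  define B where "B = diag_block_mat (map M hs)"
  define m where "m = sum_list (map n' hs)"
  define wB where "wB = block_fun n' w' hs"
  \<comment> \<open>The localizations of f to all links, concatenated in the block order of
    \<open>B\<close>.\<close>
  define T where "T f = block_fun n' (\<lambda>\<eta> r. localize \<eta> f (fl \<eta> ! r)) hs" for f
  have B: "self_adjoint m B wB"
    unfolding m_def B_def wB_def by (rule self_adjoint_diag_block_mat(1)[OF M])
  define c where "c = real (nat (k + 1) choose nat (l + 1))"
  define Q where "Q f = up_form X k f + down_form X k f" for f
  have B_norm: "weighted_norm m wB (T f) = c * face_norm X k f" for f
  proof -
    have "weighted_norm m wB (T f) = (\<Sum>\<eta>\<leftarrow>hs. weighted_norm (n' \<eta>) (w' \<eta>) (\<lambda>r. localize \<eta> f (fl \<eta> ! r)))"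
      unfolding m_def wB_def T_def by (rule self_adjoint_diag_block_mat(3)[OF M])
    also have "\<dots> = (\<Sum>\<eta>\<in>faces X l. face_norm (link X \<eta>) (k - l - 1) (localize \<eta> f))"
      unfolding hs(2)[symmetric] sum_list_distinct_conv_sum_set[OF hs(1)]
      by (intro sum.cong refl M_norm)
    also have "\<dots> = c * face_norm X k f"
      unfolding c_def using l lk by (intro sum_forms_links(1)[OF pc]) auto
    finally show ?thesis .
  qed
  have B_form: "weighted_form m B wB (T f) = real (nat k choose nat (l + 1)) * Q f
      + real (nat k choose nat l) * (real_of_int (d - k) * face_norm X k f)" for f
  proof -
    have "weighted_form m B wB (T f)
        = (\<Sum>\<eta>\<leftarrow>hs. weighted_form (n' \<eta>) (M \<eta>) (w' \<eta>) (\<lambda>r. localize \<eta> f (fl \<eta> ! r)))"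
      unfolding m_def wB_def T_def B_def by (rule self_adjoint_diag_block_mat(2)[OF M])
    also have "\<dots> = (\<Sum>\<eta>\<in>faces X l. up_form (link X \<eta>) (k - l - 1) (localize \<eta> f)
        + down_form (link X \<eta>) (k - l - 1) (localize \<eta> f))"
      unfolding hs(2)[symmetric] sum_list_distinct_conv_sum_set[OF hs(1)]
      by (intro sum.cong refl M_form)
    also have "\<dots> = real (nat k choose nat (l + 1)) * Q f
      + real (nat k choose nat l) * (real_of_int (d - k) * face_norm X k f)"
      using sum_forms_links(2,3)[OF pc l, of k f] l lk
      by (simp add: sum.distrib Q_def algebra_simps)
    finally show ?thesis .
  qed
  \<comment> \<open>On this side the dual vectors \<open>pA\<close> are kept, because cochains with
    prescribed coordinates must be built; for \<open>B\<close> coordinates are only read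
    off.\<close>
  from self_adjoint_spectral(2)[OF A] obtain pA qA where
    qA_form: "\<And>x. weighted_form n A w x
        = (\<Sum>j<n. sorted_eigenvalues A ! j * (\<Sum>i<n. qA j i * x i)\<^sup>2)"
    and qA_norm: "\<And>x. weighted_norm n w x = (\<Sum>j<n. (\<Sum>i<n. qA j i * x i)\<^sup>2)"
    and qA_pA: "\<And>j s. j < n \<Longrightarrow> s < n \<Longrightarrow> (\<Sum>i<n. qA j i * pA s i) = (if j = s then 1 else 0)"
    by blast
  from self_adjoint_spectral(2)[OF B] obtain qB where
    qB_form: "\<And>x. weighted_form m B wB x
        = (\<Sum>j<m. sorted_eigenvalues B ! j * (\<Sum>r<m. qB j r * x r)\<^sup>2)"
    and qB_norm: "\<And>x. weighted_norm m wB x = (\<Sum>j<m. (\<Sum>r<m. qB j r * x r)\<^sup>2)"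
    by blast
  \<comment> \<open>Inverting the enumeration turns an eigenvector given by indices into a cochain
    on faces, the form that localization needs.\<close>
  define idx where "idx = inv_into {..<n} ((!) (face_list X k))"
  have idx: "idx (face_list X k ! i) = i" if "i < n" for i
    unfolding idx_def using that face_list_props(1)[OF fin, of k]
    by (intro inv_into_f_f) (auto simp: inj_on_def nth_eq_iff_index_eq n_def)
  define g where "g s \<sigma> = pA s (idx \<sigma>)" for s \<sigma>
  define F where "F y \<sigma> = (\<Sum>s<n. y s * g s \<sigma>)" for y \<sigma>
  have coordA: "(\<Sum>i<n. qA j i * F y (face_list X k ! i)) = y j" if "j < n" for y j
  proof -
    have "(\<Sum>i<n. qA j i * F y (face_list X k ! i)) = (\<Sum>i<n. \<Sum>s<n. y s * (qA j i * pA s i))"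
      by (intro sum.cong refl) (simp add: F_def g_def idx sum_distrib_left mult_ac)
    also have "\<dots> = (\<Sum>s<n. \<Sum>i<n. y s * (qA j i * pA s i))"
      by (rule sum.swap)
    also have "\<dots> = (\<Sum>s<n. if s = j then y s else 0)"
      by (intro sum.cong refl) (use that in \<open>simp add: sum_distrib_left[symmetric] qA_pA\<close>)
    finally show ?thesis using that by simp
  qed
  have Q: "Q (F y) = (\<Sum>s<n. sorted_eigenvalues A ! s * (y s)\<^sup>2)" for y
    unfolding Q_def A_form[symmetric] qA_form by (simp add: coordA)
  have N: "face_norm X k (F y) = (\<Sum>s<n. (y s)\<^sup>2)" for y
    unfolding A_norm[symmetric] qA_norm by (simp add: coordA)
  \<comment> \<open>Column s holds the eigenbasis coordinates of the localized s-th eigenvector of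
    \<open>A\<close>.\<close>
  define G where "G j s = (\<Sum>r<m. qB j r * T (g s) r)" for j s
  have coordB: "(\<Sum>r<m. qB j r * T (F y) r) = (\<Sum>s<n. G j s * y s)" for j y
  proof -
    have "T (F y) r = (\<Sum>s<n. y s * T (g s) r)" for r
      unfolding T_def block_fun_linear[symmetric]
      by (simp add: localize_def F_def sum_distrib_left mult_ac)
    then have "(\<Sum>r<m. qB j r * T (F y) r) = (\<Sum>r<m. \<Sum>s<n. qB j r * T (g s) r * y s)"
      by (simp add: sum_distrib_left mult_ac)
    also have "\<dots> = (\<Sum>s<n. \<Sum>r<m. qB j r * T (g s) r * y s)"
      by (rule sum.swap)
    finally show ?thesis by (simp add: G_def sum_distrib_right)
  qed
  define b where "b = real_of_int (k + 1) / c"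
  note ratios = choose_ratios[OF l lk, folded c_def, folded b_def]
  have "b * c * sorted_eigenvalues B ! (i - 1) - real_of_int ((l + 1) * (d - k))
      \<le> real_of_int (k - l) * sorted_eigenvalues A ! (i - 1)"
  \<comment> \<open>Eigenvalues are numbered from 1 but list positions from 0, hence N = i - 1. The
    form hypothesis holds with equality.\<close>
  proof (rule min_max_comparison[where n = n and m = m and G = G])
    fix y :: "nat \<Rightarrow> real"
    show "(\<Sum>j<m. (\<Sum>s<n. G j s * y s)\<^sup>2) = c * (\<Sum>s<n. (y s)\<^sup>2)"
      unfolding coordB[symmetric] qB_norm[symmetric] B_norm N ..
    have "b * (\<Sum>j<m. sorted_eigenvalues B ! j * (\<Sum>s<n. G j s * y s)\<^sup>2)
        = (b * real (nat k choose nat (l + 1))) * Q (F y)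
          + (b * real (nat k choose nat l)) * (real_of_int (d - k) * face_norm X k (F y))"
      unfolding coordB[symmetric] qB_form[symmetric] B_form by (simp add: distrib_left)
    also have "\<dots> = real_of_int (k - l) * (\<Sum>s<n. sorted_eigenvalues A ! s * (y s)\<^sup>2)
          + real_of_int ((l + 1) * (d - k)) * (\<Sum>s<n. (y s)\<^sup>2)"
      unfolding ratios N Q by simp
    finally show "b * (\<Sum>j<m. sorted_eigenvalues B ! j * (\<Sum>s<n. G j s * y s)\<^sup>2)
        - real_of_int ((l + 1) * (d - k)) * (\<Sum>s<n. (y s)\<^sup>2)
        \<le> real_of_int (k - l) * (\<Sum>s<n. sorted_eigenvalues A ! s * (y s)\<^sup>2)"
      by simp
  next
    show "i - 1 < n"
      using assms(5,6) face_list_props(3)[OF fin, of k] by (simp add: n_def)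
    show "0 \<le> b" using ratios(1) l lk by (simp add: b_def)
  qed (use ratios(1) lk self_adjoint_spectral(1)[OF A] self_adjoint_spectral(1)[OF B]
      in \<open>auto intro: sorted_eigenvalues_nth_mono\<close>)
  moreover have "b * c = real_of_int (k + 1)"
    using ratios(1) by (simp add: b_def)
  ultimately show ?thesis
    by (simp add: nth_eigenvalue_def direct_sum_mat_def A_def B_def M_def hs_def)
qed

end
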